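(* Let $r\in\mathbb{N}$ ($r\geq 1$), let $\mu\in\mathbb{C}$ with $\Re\mu>0$, let $h:\Delta\to\mathbb{C}$ be $\mu$-spirallike, and let $Q:Y\to\mathbb{C}$ be a homogeneous polynomial of degree $r$. Then the mapping $\widehat H:\mathbb{B}\to\mathbb{C}\times Y$ defined by $$\widehat H(x,y):=\left(h(x)+h'(x)Q(y),\ h'(x)^{\frac1r}y\right)$$ is $\begin{pmatrix}\mu&0\\0&\left(\lambda+\frac{\mu}{r}\right)\mathrm{id}_Y\end{pmatrix}$-spirallike for each $\lambda\in\mathbb{C}$ with $\Re\lambda>0$ for which $$\sup_{\|y\|_Y=1}|Q(y)|\le\frac14\cdot\frac{\Re\lambda}{|\lambda|}.$$ Moreover, this bound is sharp: given $\lambda$ with $\Re\lambda>0$, for no $C>\frac14\cdot\frac{\Re\lambda}{|\lambda|}$ does the condition $\sup_{\|y\|_Y=1}|Q(y)|\le C$ imply the $\begin{pmatrix}\mu&0\\0&\left(\lambda+\frac{\mu}{r}\right)\mathrm{id}_Y\end{pmatrix}$-spirallikeness of $\widehat H$ for all $\mu$ with $\Re\mu>0$, all $\mu$-spirallike $h$ and all homogeneous polynomials $Q$ of degree $r$.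
   Context: $\Delta=\{z\in\mathbb{C}:|z|<1\}$. $(Y,\|\cdot\|_Y)$ is a (nonzero) complex Banach space, and $$\mathbb{B}:=\{(x,y)\in\mathbb{C}\times Y:\ |x|^2+\|y\|_Y^r<1\},$$ which is the open unit ball of $\mathbb{C}\times Y$ for the norm given by the Minkowski functional of $\mathbb{B}$. Homogeneous polynomials are continuous. A univalent (holomorphic, injective) function $h:\Delta\to\mathbb{C}$ is $\mu$-spirallike ($\Re\mu>0$) if $e^{-\mu t}h(\Delta)\subseteq h(\Delta)$ for all $t\ge0$ (no normalization is assumed; $0$ may lie in $h(\Delta)$ or on its boundary). The power $h'(x)^{1/r}$ denotes a fixed holomorphic branch on $\Delta$. Let $G$ be a biholomorphic mapping from a domain $D$ of a complex Banach space $X$ onto its image in $X$, and let $A$ be a bounded linear operator on $X$ such that $\Re\sigma$ is bounded away from zero (and positive) for $\sigma$ in the spectrum of $A$. Then $G$ is called $A$-spirallike if $e^{-tA}w\in G(D)$ for each $w\in G(D)$ and each $t\ge0$. The block matrix denotes the operator $(z,w)\mapsto\left(\mu z,\left(\lambda+\frac{\mu}{r}\right)w\right)$ on $\mathbb{C}\times Y$. *)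

theory Defs
  imports "HOL-Complex_Analysis.Complex_Analysis"
begin

class scaleC = scaleR +
  fixes scaleC :: "complex \<Rightarrow> 'a \<Rightarrow> 'a"  (infixr \<open>*\<^sub>C\<close> 75)
  assumes scaleR_scaleC: "scaleR a x = scaleC (complex_of_real a) x"

class complex_vector = scaleC + ab_group_add +
  assumes scaleC_add_right: "a *\<^sub>C (x + y) = a *\<^sub>C x + a *\<^sub>C y"
    and scaleC_add_left: "(a + b) *\<^sub>C x = a *\<^sub>C x + b *\<^sub>C x"
    and scaleC_scaleC: "a *\<^sub>C (b *\<^sub>C x) = (a * b) *\<^sub>C x"
    and scaleC_one: "1 *\<^sub>C x = x"

class complex_normed_vector = complex_vector + real_normed_vector +
  assumes norm_scaleC: "norm (a *\<^sub>C x) = cmod a * norm x"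

class complex_banach = complex_normed_vector + banach

instantiation complex :: complex_banach
begin

definition scaleC_complex_def: "a *\<^sub>C (x::complex) = a * x"

instance
  by standard
    (simp_all add: scaleC_complex_def scaleR_conv_of_real algebra_simps norm_mult)

end

text \<open>The library norm on a product is the Euclidean combination of the component norms. On
  \<open>complex \<times> 'y\<close> it is equivalent to the Minkowski functional of the ball \<open>unit_ball_r\<close> below, so
  openness, holomorphy, boundedness of operators and spectra are the same for either norm.\<close>

instantiation prod :: (complex_banach, complex_banach) complex_banach
begin

definition scaleC_prod_def: "a *\<^sub>C (v::'a \<times> 'b) = (a *\<^sub>C fst v, a *\<^sub>C snd v)"

instance
proof
  fix a :: real and b c :: complex and x y :: "'a \<times> 'b"
  show "a *\<^sub>R x = complex_of_real a *\<^sub>C x"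
    by (simp add: scaleC_prod_def scaleR_prod_def scaleR_scaleC)
  show "b *\<^sub>C (x + y) = b *\<^sub>C x + b *\<^sub>C y"
    by (simp add: scaleC_prod_def scaleC_add_right)
  show "(b + c) *\<^sub>C x = b *\<^sub>C x + c *\<^sub>C x"
    by (simp add: scaleC_prod_def scaleC_add_left)
  show "b *\<^sub>C c *\<^sub>C x = (b * c) *\<^sub>C x"
    by (simp add: scaleC_prod_def scaleC_scaleC)
  show "1 *\<^sub>C x = x"
    by (simp add: scaleC_prod_def scaleC_one)
  have "norm (b *\<^sub>C x) = sqrt ((cmod b)\<^sup>2 * ((norm (fst x))\<^sup>2 + (norm (snd x))\<^sup>2))"
    by (simp add: scaleC_prod_def norm_prod_def norm_scaleC power_mult_distrib algebra_simps)
  then show "norm (b *\<^sub>C x) = cmod b * norm x"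
    by (simp add: norm_prod_def real_sqrt_mult)
qed

end

definition clinear :: "('a::complex_vector \<Rightarrow> 'b::complex_vector) \<Rightarrow> bool" where
  "clinear f \<longleftrightarrow> (\<forall>x y. f (x + y) = f x + f y) \<and> (\<forall>c x. f (c *\<^sub>C x) = c *\<^sub>C f x)"

definition bounded_clinear ::
    "('a::complex_normed_vector \<Rightarrow> 'b::complex_normed_vector) \<Rightarrow> bool" where
  "bounded_clinear f \<longleftrightarrow> clinear f \<and> bounded_linear f"

definition op_spectrum :: "('a::complex_normed_vector \<Rightarrow> 'a) \<Rightarrow> complex set" where
  "op_spectrum A =
     {\<sigma>. \<not> (\<exists>B. bounded_clinear B \<and> (\<forall>v. B (A v - \<sigma> *\<^sub>C v) = v) \<and> (\<forall>v. A (B v) - \<sigma> *\<^sub>C B v = v))}"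

text \<open>For bounded \<open>A\<close> on a Banach space the exponential series converges in operator norm, hence
  its value at \<open>v\<close> is the sum of the series evaluated at \<open>v\<close>.\<close>

definition op_exp :: "('a::complex_normed_vector \<Rightarrow> 'a) \<Rightarrow> 'a \<Rightarrow> 'a" where
  "op_exp A v = (\<Sum>n. (A ^^ n) v /\<^sub>R fact n)"

text \<open>\<open>r\<close>-linear maps are modelled on functions \<open>nat \<Rightarrow> 'a\<close> of which only the values at
  \<open>0, \<dots>, r - 1\<close> matter. The norm bound is equivalent to continuity of the \<open>r\<close>-linear map.\<close>

definition bounded_multilinear ::
    "nat \<Rightarrow> ((nat \<Rightarrow> 'a::complex_normed_vector) \<Rightarrow> 'b::complex_normed_vector) \<Rightarrow> bool" where
  "bounded_multilinear r L \<longleftrightarrow>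
     (\<forall>u v. (\<forall>i<r. u i = v i) \<longrightarrow> L u = L v) \<and>
     (\<forall>i<r. \<forall>v. clinear (\<lambda>u. L (v(i := u)))) \<and>
     (\<exists>M. \<forall>v. norm (L v) \<le> M * (\<Prod>i<r. norm (v i)))"

definition homogeneous_polynomial ::
    "nat \<Rightarrow> ('a::complex_normed_vector \<Rightarrow> 'b::complex_normed_vector) \<Rightarrow> bool" where
  "homogeneous_polynomial r Q \<longleftrightarrow>
     (\<exists>L. bounded_multilinear r L \<and> (\<forall>y. Q y = L (\<lambda>_. y)))"

definition frechet_holomorphic_on ::
    "('a::complex_normed_vector \<Rightarrow> 'b::complex_normed_vector) \<Rightarrow> 'a set \<Rightarrow> bool" where
  "frechet_holomorphic_on f D \<longleftrightarrow>
     open D \<and> (\<forall>x\<in>D. \<exists>f'. bounded_clinear f' \<and> (f has_derivative f') (at x))"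

definition domain_in :: "'a::complex_normed_vector set \<Rightarrow> bool" where
  "domain_in D \<longleftrightarrow> open D \<and> connected D \<and> D \<noteq> {}"

definition biholomorphic_on_image :: "'a::complex_banach set \<Rightarrow> ('a \<Rightarrow> 'a) \<Rightarrow> bool" where
  "biholomorphic_on_image D G \<longleftrightarrow>
     domain_in D \<and> frechet_holomorphic_on G D \<and> inj_on G D \<and>
     open (G ` D) \<and> frechet_holomorphic_on (inv_into D G) (G ` D)"

definition op_spirallike ::
    "('a::complex_banach \<Rightarrow> 'a) \<Rightarrow> 'a set \<Rightarrow> ('a \<Rightarrow> 'a) \<Rightarrow> bool" where
  "op_spirallike A D G \<longleftrightarrow>
     biholomorphic_on_image D G \<and>
     bounded_clinear A \<and> (\<exists>\<delta>>0. \<forall>\<sigma>\<in>op_spectrum A. \<delta> \<le> Re \<sigma>) \<and>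
     (\<forall>w\<in>G ` D. \<forall>t\<ge>0. op_exp (\<lambda>v. (- t) *\<^sub>R A v) w \<in> G ` D)"

definition disc_spirallike :: "complex \<Rightarrow> (complex \<Rightarrow> complex) \<Rightarrow> bool" where
  "disc_spirallike \<mu> h \<longleftrightarrow>
     0 < Re \<mu> \<and> h holomorphic_on ball 0 1 \<and> inj_on h (ball 0 1) \<and>
     (\<forall>t\<ge>0. (\<lambda>w. exp (- \<mu> * complex_of_real t) * w) ` h ` ball 0 1 \<subseteq> h ` ball 0 1)"

definition unit_ball_r :: "nat \<Rightarrow> (complex \<times> 'y::complex_banach) set" where
  "unit_ball_r r = {(x, y). (cmod x)\<^sup>2 + norm y ^ r < 1}"

definition root_branch :: "nat \<Rightarrow> (complex \<Rightarrow> complex) \<Rightarrow> (complex \<Rightarrow> complex) \<Rightarrow> bool" where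
  "root_branch r g p \<longleftrightarrow> p holomorphic_on ball 0 1 \<and> (\<forall>x\<in>ball 0 1. p x ^ r = g x)"

text \<open>The argument \<open>p\<close> stands for the chosen branch of \<open>(deriv h)\<^bsup>1/r\<^esup>\<close>.\<close>

definition H_hat :: "(complex \<Rightarrow> complex) \<Rightarrow> (complex \<Rightarrow> complex) \<Rightarrow> ('y \<Rightarrow> complex) \<Rightarrow>
    complex \<times> 'y::complex_banach \<Rightarrow> complex \<times> 'y" where
  "H_hat h p Q = (\<lambda>(x, y). (h x + deriv h x * Q y, p x *\<^sub>C y))"

definition block_op :: "nat \<Rightarrow> complex \<Rightarrow> complex \<Rightarrow>
    complex \<times> 'y::complex_banach \<Rightarrow> complex \<times> 'y" where
  "block_op r \<mu> \<nu> = (\<lambda>(z, w). (\<mu> * z, (\<nu> + \<mu> / of_nat r) *\<^sub>C w))"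

end

theory Submission imports Defs begin

text \<open>
  Since \<open>p ^ r = deriv h\<close> and \<open>Q\<close> is homogeneous of degree \<open>r\<close>, the mapping sends \<open>(x, y)\<close> to
  \<open>(h x + Q w, w)\<close> with \<open>w = p x y\<close>. Hence it has an explicit inverse, and \<open>(z, w)\<close> lies in its
  image iff \<open>z - Q w = h u\<close> for some \<open>u\<close> in the disc with \<open>\<parallel>w\<parallel> ^ r < R u\<close>, where
  \<open>R u = (1 - \<bar>u\<bar> ^ 2) \<bar>h' u\<bar>\<close> is the conformal radius of \<open>h(\<Delta>)\<close> at \<open>h u\<close>.

  Under the linear flow \<open>h u\<close> becomes \<open>exp (- \<mu> t) (h u + d)\<close> with \<open>d = (1 - exp (- r \<nu> t)) Q w\<close>,
  and the bound on \<open>Q\<close> gives \<open>4 \<bar>d\<bar> \<le> (1 - exp (- r t Re \<nu>)) \<parallel>w\<parallel> ^ r\<close>. As a function on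
  \<open>h(\<Delta>)\<close> the conformal radius is 4-Lipschitz, by Bieberbach's inequality \<open>\<bar>f'' 0\<bar> \<le> 4 \<bar>f' 0\<bar>\<close>, and
  by the Schwarz lemma it shrinks at most by the factor \<open>exp (- t Re \<mu>)\<close> under the spiral contraction
  of \<open>h(\<Delta>)\<close>. So the image is invariant.

  For sharpness take \<open>h\<close> onto the plane slit along the negative real axis and \<open>Q = c \<phi> ^ r\<close> with a
  functional \<open>\<phi>\<close> of norm 1 that attains its norm. There \<open>R u \<le> 4 \<bar>h u\<bar>\<close>, so invariance would give
  \<open>exp (- s Re \<nu>) \<le> \<bar>1 + 4 c (1 - exp (- s \<nu>))\<bar>\<close>, which fails for small \<open>s\<close> when \<open>\<bar>c\<bar> = C\<close> and
  \<open>c \<nu> < 0\<close>.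
\<close>

text \<open>The entry \<open>\<mu> / r\<close> is what makes the criterion for the image compatible
  with the flow: if \<open>w\<close> is multiplied by \<open>e\<close>, then
  \<open>e ^ r = exp (- \<mu> t) * exp (- r \<nu> t)\<close>, so \<open>Q w\<close> and
  \<open>\<parallel>w\<parallel> ^ r\<close> carry the factor of the first coordinate and a factor
  in \<open>\<nu>\<close> alone. Once the common factor is removed, two effects compete inside the
  fixed domain \<open>h(\<Delta>)\<close>: the radius that has to fit shrinks, while its centre
  moves by \<open>d\<close>, at a cost of at most \<open>4 \<bar>d\<bar>\<close>. Thus 1/4 is the
  reciprocal of the Lipschitz constant, and \<open>Re \<nu> / \<bar>\<nu>\<bar>\<close> comes from
  \<open>\<bar>1 - exp (- \<nu> s)\<bar> \<le> \<bar>\<nu>\<bar> / Re \<nu> * (1 - exp (- s Re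
  \<nu>))\<close>, an equality to first order at \<open>s = 0\<close>. The slit plane exhausts both:
  its tip 0 gives equality in the quarter theorem, and the argument of \<open>c\<close> sends the
  centre straight towards the tip. Since \<open>h\<close> is not normalised and 0 may be a boundary
  point of \<open>h(\<Delta>)\<close>, the flow is followed on the image for finite times instead of
  through a differential inequality for \<open>h\<close>.\<close>

unbundle no fps_syntax

section \<open>Area of an image under a real-differentiable map of the plane\<close>

text \<open>A bridge between \<open>real ^ 2\<close>, where the change of variables formula is used,
  and pairs, where Fubini's theorem applies. The coordinate map sends boxes to boxes of the same
  content, so integrals carry over unchanged.\<close>

lemma integral_cbox_vec2:
  fixes f :: "real \<Rightarrow> real \<Rightarrow> real"
  assumes cont: "continuous_on ({a..b} \<times> {c..d}) (\<lambda>(s, t). f s t)"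
  shows "((\<lambda>v. f (v $ 1) (v $ 2)) has_integral integral {a..b} (\<lambda>s. integral {c..d} (f s)))
           (cbox (vector [a, c]) (vector [b, d]) :: (real ^ 2) set)"
proof -
  let ?g = "\<lambda>v :: real ^ 2. (v $ 1, v $ 2)" and ?h = "\<lambda>p :: real \<times> real. vector [fst p, snd p] :: real ^ 2"
  have gh: "?g (?h p) = p" for p by simp
  have hg: "?h (?g v) = v" for v by (simp add: vec_eq_iff forall_2)
  have mem: "v \<in> cbox u w \<longleftrightarrow> ?g v \<in> cbox (?g u) (?g w)" for u v w :: "real ^ 2"
    by (auto simp: mem_box_cart forall_2 cbox_Pair_eq)
  have gim: "?g ` cbox u w = cbox (?g u) (?g w)" for u w :: "real ^ 2"
  proof -
    have "p \<in> ?g ` cbox u w" if "p \<in> cbox (?g u) (?g w)" for p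
      by (rule image_eqI[of _ _ "?h p"]) (use that mem[of "?h p" u w] in \<open>auto simp: gh\<close>)
    then show ?thesis using mem by auto
  qed
  have him: "?h ` cbox p q = cbox (?h p) (?h q)" for p q
  proof -
    have "?h ` cbox p q = ?h ` ?g ` cbox (?h p) (?h q)"
      by (simp only: gim gh)
    also have "\<dots> = cbox (?h p) (?h q)"
      by (simp only: image_image hg image_ident)
    finally show ?thesis .
  qed
  have content: "measure lborel (?g ` cbox u w) = 1 * measure lborel (cbox u w)" for u w :: "real ^ 2"
  proof (cases "cbox u w = {}")
    case False
    then have "u $ i \<le> w $ i" for i by (auto simp: interval_eq_empty_cart not_less)
    then show ?thesis using False
      by (simp add: gim content_Pair content_cbox_cart prod_2 UNIV_2)
  qed (simp add: gim[symmetric])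
  have cc: "continuous_on (cbox (a, c) (b, d)) (\<lambda>(s, t). f s t)"
    using cont by (simp add: cbox_Pair_eq)
  have "((\<lambda>(s, t). f s t) has_integral integral (cbox (a, c) (b, d)) (\<lambda>(s, t). f s t)) (cbox (a, c) (b, d))"
    using cc by (intro integrable_integral integrable_continuous)
  also have "integral (cbox (a, c) (b, d)) (\<lambda>(s, t). f s t) = integral {a..b} (\<lambda>s. integral {c..d} (f s))"
    using integral_prod_continuous[OF cc] by simp
  finally have I: "((\<lambda>(s, t). f s t) has_integral integral {a..b} (\<lambda>s. integral {c..d} (f s))) (cbox (a, c) (b, d))" .
  have "((\<lambda>v. (\<lambda>(s, t). f s t) (?g v)) has_integral (1 / 1) *\<^sub>R integral {a..b} (\<lambda>s. integral {c..d} (f s)))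
      (?h ` cbox (a, c) (b, d))"
  proof (rule has_integral_twiddle[OF _ hg gh _ _ _ content I])
    show "continuous (at x) ?g" for x :: "real ^ 2"
      by (intro continuous_intros)
    show "\<exists>w z. ?g ` cbox u v = cbox w z" for u v
      unfolding gim by blast
    show "\<exists>w z. ?h ` cbox p q = cbox w z" for p q
      unfolding him by blast
  qed simp
  then show ?thesis by (simp only: him) simp
qed

text \<open>The real Jacobian in terms of the Wirtinger derivatives \<open>D\<close> and
  \<open>E\<close>. The antilinear part is there because the map of the area theorem is made
  non-holomorphic on purpose.\<close>

lemma det_complex_linear_plus_antilinear:
  fixes D E :: complex
  defines "L \<equiv> \<lambda>h :: real ^ 2. vector [Re (D * Complex (h $ 1) (h $ 2) + E * cnj (Complex (h $ 1) (h $ 2))),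
                                    Im (D * Complex (h $ 1) (h $ 2) + E * cnj (Complex (h $ 1) (h $ 2)))] :: real ^ 2"
  shows "det (matrix L) = (cmod D)\<^sup>2 - (cmod E)\<^sup>2"
  by (simp add: L_def det_2 matrix_def axis_def cmod_power2) algebra

text \<open>For an injective map the area of the image is the integral of the absolute Jacobian, and
  the image lies in a disc of radius \<open>\<rho>\<close>. Injectivity is asked on the open
  rectangle because \<open>exp\<close> identifies the sides \<open>Im = 0\<close> and
  \<open>Im = 2 * pi\<close>; the iterated form lets circle means be inserted later.\<close>

lemma area_image_le:
  fixes F :: "complex \<Rightarrow> complex"
  assumes der: "\<And>s t. a < s \<Longrightarrow> s < b \<Longrightarrow> c < t \<Longrightarrow> t < d \<Longrightarrow>
      (F has_derivative (\<lambda>v. D s t * v + E s t * cnj v)) (at (Complex s t))"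
    and inj: "inj_on F {z. a < Re z \<and> Re z < b \<and> c < Im z \<and> Im z < d}"
    and cont: "continuous_on ({a..b} \<times> {c..d}) (\<lambda>(s, t). D s t)"
      "continuous_on ({a..b} \<times> {c..d}) (\<lambda>(s, t). E s t)"
    and bound: "\<And>z. a < Re z \<Longrightarrow> Re z < b \<Longrightarrow> c < Im z \<Longrightarrow> Im z < d \<Longrightarrow> cmod (F z) \<le> \<rho>"
    and "0 \<le> \<rho>"
  shows "integral {a..b} (\<lambda>s. integral {c..d} (\<lambda>t. \<bar>(cmod (D s t))\<^sup>2 - (cmod (E s t))\<^sup>2\<bar>)) \<le> pi * \<rho>\<^sup>2"
proof -
  define C :: "real ^ 2 \<Rightarrow> complex" where "C v = Complex (v $ 1) (v $ 2)" for v :: "real ^ 2"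
  define V :: "complex \<Rightarrow> real ^ 2" where "V z = vector [Re z, Im z]" for z
  define J where "J s t = \<bar>(cmod (D s t))\<^sup>2 - (cmod (E s t))\<^sup>2\<bar>" for s t
  define B :: "(real ^ 2) set" where "B = box (vector [a, c]) (vector [b, d])"
  define f where "f v = V (F (C v))" for v
  define f' :: "real ^ 2 \<Rightarrow> real ^ 2 \<Rightarrow> real ^ 2"
    where "f' v h = V (D (v $ 1) (v $ 2) * C h + E (v $ 1) (v $ 2) * cnj (C h))" for v h :: "real ^ 2"
  have V_inj: "V z = V w \<Longrightarrow> z = w" for z w
    by (auto simp: V_def vec_eq_iff forall_2 complex_eq_iff)
  have C_inj: "C v = C w \<Longrightarrow> v = w" for v w
    by (auto simp: C_def vec_eq_iff forall_2)
  have linV: "linear V"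
    by (rule linearI) (auto simp: V_def vec_eq_iff forall_2)
  have linC: "linear C"
    by (rule linearI) (auto simp: C_def complex_eq_iff)
  have normV: "norm (V z) = cmod z" for z
    by (simp add: V_def norm_vec_def L2_set_def UNIV_2 cmod_def)
  have B: "v \<in> B \<longleftrightarrow> a < Re (C v) \<and> Re (C v) < b \<and> c < Im (C v) \<and> Im (C v) < d" for v
    by (auto simp: B_def mem_box_cart forall_2 C_def)
  have der_f: "(f has_derivative f' v) (at v within B)" if "v \<in> B" for v
  proof -
    have "(F has_derivative (\<lambda>h. D (v $ 1) (v $ 2) * h + E (v $ 1) (v $ 2) * cnj h)) (at (C v))"
      unfolding C_def by (rule der) (use that in \<open>auto simp: B C_def\<close>)
    moreover have "(C has_derivative C) (at v)"
      using linC by (intro bounded_linear_imp_has_derivative linear_conv_bounded_linear[THEN iffD1])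
    moreover have "(V has_derivative V) (at z)" for z
      using linV by (intro bounded_linear_imp_has_derivative linear_conv_bounded_linear[THEN iffD1])
    ultimately have "((\<lambda>v. V (F (C v))) has_derivative
        (\<lambda>h. V (D (v $ 1) (v $ 2) * C h + E (v $ 1) (v $ 2) * cnj (C h)))) (at v)"
      using has_derivative_compose[OF has_derivative_compose, of C C v UNIV F _ V V] by simp
    then show ?thesis
      unfolding f_def[abs_def] f'_def[abs_def] by (rule has_derivative_at_withinI)
  qed
  have det: "\<bar>det (matrix (f' v))\<bar> = J (v $ 1) (v $ 2)" for v
    unfolding f'_def[abs_def] V_def C_def J_def det_complex_linear_plus_antilinear ..
  have inj_f: "inj_on f B"
    unfolding f_def by (rule inj_onI) (use inj in \<open>auto simp: inj_on_def B dest!: V_inj intro: C_inj\<close>)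
  have "continuous_on ({a..b} \<times> {c..d}) (\<lambda>(s, t). J s t)"
    using cont unfolding J_def case_prod_unfold by (intro continuous_intros)
  from integral_cbox_vec2[OF this]
  have I: "((\<lambda>v. J (v $ 1) (v $ 2)) has_integral integral {a..b} (\<lambda>s. integral {c..d} (J s))) B"
    unfolding B_def by (simp add: has_integral_open_interval)
  have B_leb: "B \<in> sets lebesgue"
    unfolding B_def by (simp add: lmeasurable_box fmeasurableD)
  have int: "(\<lambda>v. \<bar>det (matrix (f' v))\<bar>) integrable_on B"
    using I by (auto simp: det integrable_on_def)
  have "f ` B \<subseteq> cball 0 \<rho>"
    using bound by (auto simp: f_def normV B)
  moreover have "f ` B \<in> lmeasurable"
    using measurable_differentiable_image_eq[OF B_leb der_f inj_f] int by blast
  ultimately have "measure lebesgue (f ` B) \<le> measure lebesgue (cball 0 \<rho> :: (real ^ 2) set)"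
    by (intro measure_mono_fmeasurable) (auto simp: fmeasurableD)
  also have "\<dots> = pi * \<rho>\<^sup>2"
    using \<open>0 \<le> \<rho>\<close> content_cball[of \<rho> "0 :: real ^ 2"] by (simp add: unit_ball_vol_2)
  also have "measure lebesgue (f ` B) = integral B (\<lambda>v. \<bar>det (matrix (f' v))\<bar>)"
    by (rule measure_differentiable_image_eq[OF B_leb der_f inj_f int])
  also have "\<dots> = integral {a..b} (\<lambda>s. integral {c..d} (J s))"
    using I by (simp add: det integral_unique)
  finally show ?thesis unfolding J_def .
qed

section \<open>Mean values on circles\<close>

text \<open>Cauchy's integral formula for the \<open>k\<close>-th derivative at 0, multiplied by
  \<open>\<rho> ^ k / \<i>\<close> and written in the angle.\<close>

lemma circle_mean_coeff:
  fixes f :: "complex \<Rightarrow> complex" and \<rho> :: real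
  assumes holf: "f holomorphic_on ball 0 1" and \<rho>: "0 < \<rho>" "\<rho> < 1"
  shows "((\<lambda>t. f (\<rho> * cis t) * cis (- (real k * t))) has_integral
           2 * pi * \<rho> ^ k * ((deriv ^^ k) f 0 / fact k)) {0..2 * pi}"
proof -
  have "((\<lambda>u. f u / (u - 0) ^ Suc k) has_contour_integral 2 * pi * \<i> / fact k * (deriv ^^ k) f 0)
          (circlepath 0 \<rho>)"
  proof (rule Cauchy_has_contour_integral_higher_derivative_circlepath)
    have "cball 0 \<rho> \<subseteq> ball (0 :: complex) 1" using \<rho> by auto
    then show "continuous_on (cball 0 \<rho>) f"
      using holf holomorphic_on_imp_continuous_on continuous_on_subset by blast
    show "f holomorphic_on ball 0 \<rho>"
      using holf \<rho> by (auto elim!: holomorphic_on_subset)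
  qed (use \<rho> in auto)
  then have "((\<lambda>t. f (0 + \<rho> * cis t) / (0 + \<rho> * cis t - 0) ^ Suc k * \<rho> * \<i> * cis t) has_integral
      2 * pi * \<i> / fact k * (deriv ^^ k) f 0) {0..2 * pi}"
    unfolding circlepath_def by (subst (asm) has_contour_integral_part_circlepath_iff) auto
  from has_integral_mult_right[OF this, of "\<rho> ^ k / \<i>"]
  have I: "((\<lambda>t. \<rho> ^ k / \<i> * (f (0 + \<rho> * cis t) / (0 + \<rho> * cis t - 0) ^ Suc k * \<rho> * \<i> * cis t)) has_integral
      \<rho> ^ k / \<i> * (2 * pi * \<i> / fact k * (deriv ^^ k) f 0)) {0..2 * pi}" .
  have "\<rho> ^ k / \<i> * (f (0 + \<rho> * cis t) / (0 + \<rho> * cis t - 0) ^ Suc k * \<rho> * \<i> * cis t)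
      = f (\<rho> * cis t) * cis (- (real k * t))" for t
  proof -
    have "cis (- (real k * t)) = inverse (cis t ^ k)"
      by (simp add: Complex.DeMoivre flip: cis_inverse)
    then show ?thesis using \<rho> by (simp add: field_simps power_mult_distrib)
  qed
  with I show ?thesis by (simp add: mult_ac)
qed

text \<open>Bessel's inequality for the Fourier modes 0 and 2: with \<open>v\<close> the sum of
  these two components of \<open>f\<close>, integrate \<open>2 * Re (f * cnj v) - \<bar>v\<bar> ^ 2
  \<le> \<bar>f\<bar> ^ 2\<close>.\<close>

lemma circle_mean_norm_ge:
  fixes f :: "complex \<Rightarrow> complex" and \<rho> :: real
  assumes holf: "f holomorphic_on ball 0 1" and \<rho>: "0 < \<rho>" "\<rho> < 1"
  shows "2 * pi * ((cmod (f 0))\<^sup>2 + (cmod ((deriv ^^ 2) f 0 / 2))\<^sup>2 * \<rho> ^ 4)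
           \<le> integral {0..2 * pi} (\<lambda>t. (cmod (f (\<rho> * cis t)))\<^sup>2)"
proof -
  define \<alpha> \<beta> where "\<alpha> = f 0" and "\<beta> = (deriv ^^ 2) f 0 / 2"
  define K where "K = (cmod \<alpha>)\<^sup>2 + (cmod \<beta>)\<^sup>2 * \<rho> ^ 4"
  have Kc: "complex_of_real K = cnj \<alpha> * \<alpha> + cnj \<beta> * \<beta> * \<rho> ^ 4"
    by (simp only: K_def of_real_add of_real_mult complex_norm_square) simp
  define v where "v t = \<alpha> + \<beta> * \<rho>\<^sup>2 * cis (2 * t)" for t
  have 0: "((\<lambda>t. f (\<rho> * cis t)) has_integral 2 * pi * \<alpha>) {0..2 * pi}"
    using circle_mean_coeff[OF assms, of 0] by (simp add: \<alpha>_def)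
  have 2: "((\<lambda>t. f (\<rho> * cis t) * cis (- (2 * t))) has_integral 2 * pi * \<rho>\<^sup>2 * \<beta>) {0..2 * pi}"
    using circle_mean_coeff[OF assms, of 2] by (simp add: \<beta>_def)
  have "((\<lambda>t. cnj \<alpha> * f (\<rho> * cis t) + cnj \<beta> * \<rho>\<^sup>2 * (f (\<rho> * cis t) * cis (- (2 * t)))) has_integral
      cnj \<alpha> * (2 * pi * \<alpha>) + cnj \<beta> * \<rho>\<^sup>2 * (2 * pi * \<rho>\<^sup>2 * \<beta>)) {0..2 * pi}"
    using has_integral_add[OF has_integral_mult_right[OF 0] has_integral_mult_right[OF 2]] .
  also have "(\<lambda>t. cnj \<alpha> * f (\<rho> * cis t) + cnj \<beta> * \<rho>\<^sup>2 * (f (\<rho> * cis t) * cis (- (2 * t))))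
      = (\<lambda>t. f (\<rho> * cis t) * cnj (v t))"
    by (auto simp: v_def algebra_simps cis_cnj)
  also have "cnj \<alpha> * (2 * pi * \<alpha>) + cnj \<beta> * \<rho>\<^sup>2 * (2 * pi * \<rho>\<^sup>2 * \<beta>) = of_real (2 * pi * K)"
    by (simp add: Kc algebra_simps power2_eq_square power4_eq_xxxx)
  finally have "((\<lambda>t. f (\<rho> * cis t) * cnj (v t)) has_integral of_real (2 * pi * K)) {0..2 * pi}" .
  from has_integral_Re[OF this]
  have "((\<lambda>t. Re (f (\<rho> * cis t) * cnj (v t))) has_integral 2 * pi * K) {0..2 * pi}"
    by (simp only: Re_complex_of_real)
  from has_integral_mult_right[OF this, of 2]
  have I1: "((\<lambda>t. 2 * Re (f (\<rho> * cis t) * cnj (v t))) has_integral 4 * pi * K) {0..2 * pi}"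
    by (simp add: mult.assoc)
  \<comment> \<open>The cross term of \<open>\<bar>v\<bar> ^ 2\<close> has mean zero, being a
    multiple of \<open>z ^ 2\<close> whose mean is its value at 0.\<close>
  have "((\<lambda>t. 2 * cnj \<alpha> * \<beta> * (\<rho> * cis t)\<^sup>2) has_integral 0) {0..2 * pi}"
    using circle_mean_coeff[of "\<lambda>z. 2 * cnj \<alpha> * \<beta> * z\<^sup>2" \<rho> 0] \<rho>
    by (simp add: holomorphic_intros)
  from has_integral_add[OF has_integral_const_real[of K 0 "2 * pi"] has_integral_Re[OF this]]
  have "((\<lambda>t. K + Re (2 * cnj \<alpha> * \<beta> * (\<rho> * cis t)\<^sup>2)) has_integral (2 * pi * K + 0)) {0..2 * pi}"
    by (simp add: mult_ac)
  also have "(\<lambda>t. K + Re (2 * cnj \<alpha> * \<beta> * (\<rho> * cis t)\<^sup>2)) = (\<lambda>t. (cmod (v t))\<^sup>2)"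
  proof
    fix t
    have "complex_of_real ((cmod (v t))\<^sup>2) =
        of_real K + cnj \<alpha> * \<beta> * (\<rho> * cis t)\<^sup>2 + cnj (cnj \<alpha> * \<beta> * (\<rho> * cis t)\<^sup>2)"
      unfolding complex_norm_square Kc v_def
      by (simp add: algebra_simps power2_eq_square power4_eq_xxxx cis_mult cis_cnj)
    moreover have "Re (of_real k + w + cnj w) = k + Re (2 * w)" for k w
      by simp
    ultimately have "Re (complex_of_real ((cmod (v t))\<^sup>2)) = K + Re (2 * (cnj \<alpha> * \<beta> * (\<rho> * cis t)\<^sup>2))"
      by presburger
    then show "K + Re (2 * cnj \<alpha> * \<beta> * (\<rho> * cis t)\<^sup>2) = (cmod (v t))\<^sup>2"
      by (simp only: Re_complex_of_real mult.assoc)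
  qed
  finally have I2: "((\<lambda>t. (cmod (v t))\<^sup>2) has_integral 2 * pi * K) {0..2 * pi}" by simp
  have "continuous_on {0..2 * pi} (\<lambda>t. (cmod (f (\<rho> * cis t)))\<^sup>2)"
    by (intro continuous_intros continuous_on_compose2[OF holomorphic_on_imp_continuous_on[OF holf]])
      (use \<rho> in \<open>auto simp: norm_mult\<close>)
  then have "((\<lambda>t. (cmod (f (\<rho> * cis t)))\<^sup>2) has_integral
      integral {0..2 * pi} (\<lambda>t. (cmod (f (\<rho> * cis t)))\<^sup>2)) {0..2 * pi}"
    by (intro integrable_integral integrable_continuous_interval)
  moreover have "2 * Re (x * cnj y) - (cmod y)\<^sup>2 \<le> (cmod x)\<^sup>2" for x y
  proof -
    show ?thesis
      using sum_power2_ge_zero[of "Re x - Re y" "Im x - Im y"] unfolding cmod_power2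
      by (simp add: power2_eq_square algebra_simps)
  qed
  ultimately have "4 * pi * K - 2 * pi * K \<le> integral {0..2 * pi} (\<lambda>t. (cmod (f (\<rho> * cis t)))\<^sup>2)"
    using has_integral_le[OF has_integral_diff[OF I1 I2]] by blast
  then show ?thesis by (simp add: K_def \<alpha>_def \<beta>_def)
qed

lemma holomorphic_taylor2:
  assumes holm: "m holomorphic_on ball 0 1" and R: "0 < R" "R < 1"
  obtains c where "0 \<le> c" "\<And>z. cmod z \<le> R \<Longrightarrow>
    cmod (m z - (m 0 + deriv m 0 * z + (deriv ^^ 2) m 0 / 2 * z\<^sup>2)) \<le> c * cmod z ^ 3"
proof -
  have sub: "cball 0 R \<subseteq> ball (0 :: complex) 1" using R by auto
  have hol: "(deriv ^^ i) m holomorphic_on ball 0 1" for i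
    by (simp add: holm holomorphic_higher_deriv)
  have "continuous_on (cball 0 R) ((deriv ^^ 3) m)"
    using hol sub holomorphic_on_imp_continuous_on continuous_on_subset by blast
  then have "bounded ((deriv ^^ 3) m ` cball 0 R)"
    by (intro compact_imp_bounded compact_continuous_image) auto
  then obtain B where B: "0 < B" "\<And>z. z \<in> cball 0 R \<Longrightarrow> cmod ((deriv ^^ 3) m z) \<le> B"
    by (auto simp: bounded_pos)
  have "cmod (m z - (m 0 + deriv m 0 * z + (deriv ^^ 2) m 0 / 2 * z\<^sup>2)) \<le> B / 2 * cmod z ^ 3"
    if "cmod z \<le> R" for z
  proof -
    have "cmod ((deriv ^^ 0) m z - (\<Sum>i\<le>2. (deriv ^^ i) m 0 * (z - 0) ^ i / fact i))
        \<le> B * cmod (z - 0) ^ Suc 2 / fact 2"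
    proof (rule complex_Taylor[where f = "\<lambda>i. (deriv ^^ i) m" and S = "cball 0 R" and n = 2])
      fix i x assume "x \<in> cball (0 :: complex) R"
      then have "((deriv ^^ i) m has_field_derivative deriv ((deriv ^^ i) m) x) (at x)"
        using hol sub by (intro holomorphic_derivI[of _ "ball 0 1"]) auto
      then show "((deriv ^^ i) m has_field_derivative (deriv ^^ Suc i) m x) (at x within cball 0 R)"
        by (simp add: has_field_derivative_at_within)
    next
      show "cmod ((deriv ^^ Suc 2) m x) \<le> B" if "x \<in> cball 0 R" for x
        using B(2)[OF that] by (simp add: numeral_3_eq_3 numeral_2_eq_2)
    qed (use that R in auto)
    moreover have "(\<Sum>i\<le>2. (deriv ^^ i) m 0 * (z - 0) ^ i / fact i)
        = m 0 + deriv m 0 * z + (deriv ^^ 2) m 0 / 2 * z\<^sup>2"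
      by (simp add: numeral_2_eq_2)
    ultimately show ?thesis by (simp add: numeral_3_eq_3 numeral_2_eq_2)
  qed
  with B that[of "B / 2"] show ?thesis by simp
qed

text \<open>With \<open>X = 1 / \<bar>z\<bar>\<close> and \<open>B = \<bar>b\<bar>\<close>, the left
  side will bound the corrected map on the circle through \<open>z\<close>; the middle term vanishes
  at \<open>X = Y\<close>. The conclusion puts the image of the whole annulus, not only of its inner
  circle, into a disc of radius \<open>Y + O(1 / Y ^ 2)\<close>. The middle term uses up at most
  half of the gap \<open>Y - X\<close>, and the other half is left for the remainder.\<close>

lemma near_ellipse_bound:
  fixes X Y B c :: real
  assumes "1 \<le> X" "X \<le> Y" "0 \<le> B" "4 * B \<le> Y" "0 \<le> c" "8 * c \<le> Y"
  shows "X + B * (1 / X - X / Y\<^sup>2) + 2 * c / X\<^sup>2 \<le> Y + 8 * c / Y\<^sup>2"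
proof -
  have pos: "0 < X" "0 < Y" using assms by auto
  have "4 * B \<le> X * Y" using assms mult_mono[of 1 X "4 * B" Y] by simp
  have "B * (1 / X - X / Y\<^sup>2) = (Y - X) * (B * (Y + X) / (X * Y\<^sup>2))"
    using pos by (simp add: field_simps power2_eq_square)
  also have "\<dots> \<le> (Y - X) * (1 / 2)"
  proof (rule mult_left_mono)
    have "B * (Y + X) \<le> B * (2 * Y)" using assms by (intro mult_left_mono) auto
    also have "\<dots> \<le> (X * Y) * Y / 2" using \<open>4 * B \<le> X * Y\<close> pos by simp
    finally show "B * (Y + X) / (X * Y\<^sup>2) \<le> 1 / 2"
      using pos by (simp add: field_simps power2_eq_square)
  qed (use assms in simp)
  finally have *: "X + B * (1 / X - X / Y\<^sup>2) \<le> Y - (Y - X) / 2" by argo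
  \<comment> \<open>For \<open>X \<ge> Y / 2\<close> the remainder is at most its value
    \<open>8 * c / Y\<^sup>2\<close> at \<open>Y / 2\<close>; for smaller \<open>X\<close> the spare
    \<open>(Y - X) / 2\<close> exceeds \<open>Y / 4 \<ge> 2 * c\<close>.\<close>
  show ?thesis
  proof (cases "Y / 2 \<le> X")
    case True
    then have "(Y / 2)\<^sup>2 \<le> X\<^sup>2" using pos by (intro power_mono) auto
    then have "2 * c / X\<^sup>2 \<le> 2 * c / (Y / 2)\<^sup>2"
      using assms pos by (intro divide_left_mono) auto
    also have "\<dots> = 8 * c / Y\<^sup>2" by (simp add: power_divide)
    finally have "2 * c / X\<^sup>2 \<le> 8 * c / Y\<^sup>2" .
    from add_mono[OF * this] show ?thesis
      by (rule order.trans) (use \<open>X \<le> Y\<close> in argo)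
  next
    case False
    have "1 \<le> X\<^sup>2" using assms by simp
    then have "2 * c / X\<^sup>2 \<le> 2 * c" using assms pos by (simp add: divide_le_eq mult_left_mono mult_le_cancel_left1)
    moreover have "0 \<le> 8 * c / Y\<^sup>2" using assms by simp
    moreover have "Y - (Y - X) / 2 + 2 * c \<le> Y" using False assms by argo
    ultimately show ?thesis using * by argo
  qed
qed

section \<open>The area theorem\<close>

text \<open>The area of the image of \<open>1 / Y < \<bar>z\<bar> < 1 / A\<close> under \<open>g z = m z / z\<close> is compared with that of a disc.
  The circle \<open>\<bar>z\<bar> = 1 / Y\<close> is mapped almost to an ellipse with half-axes \<open>Y \<plusminus> \<bar>b\<bar> / Y\<close>, so \<open>g\<close> is first
  composed with the linear map \<open>v \<mapsto> v - \<beta> * cnj v\<close>, \<open>\<beta> = b / Y\<^sup>2\<close>, which turns this ellipse into a circle.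
  The domain is parametrised by \<open>exp\<close> on a rectangle, which makes the area integral iterated.\<close>

theorem area_theorem:
  fixes m :: "complex \<Rightarrow> complex"
  assumes holm: "m holomorphic_on ball 0 1" and m0: "m 0 = 1" and m1: "deriv m 0 = 0"
    and inj: "inj_on (\<lambda>z. m z / z) (ball 0 1 - {0})"
  shows "cmod ((deriv ^^ 2) m 0) \<le> 2"
proof -
  define b where "b = (deriv ^^ 2) m 0 / 2"
  define B where "B = (cmod b)\<^sup>2"
  \<comment> \<open>\<open>M z\<close> is \<open>- z ^ 2\<close> times the derivative of
    \<open>m z / z\<close>. Its Taylor coefficients of index 0, 1, 2 are 1, 0 and
    \<open>- b\<close>.\<close>
  define M where "M z = m z - z * deriv m z" for z
  have hol': "deriv m holomorphic_on ball 0 1" "deriv (deriv m) holomorphic_on ball 0 1"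
    by (auto intro: holomorphic_deriv holm)
  have holM: "M holomorphic_on ball 0 1"
    unfolding M_def by (intro holomorphic_intros holm hol')
  have M0: "M 0 = 1" by (simp add: M_def m0)
  have M2: "(deriv ^^ 2) M 0 = - 2 * b"
  proof -
    have dM: "deriv M z = - z * deriv (deriv m) z" if "z \<in> ball 0 1" for z
    proof -
      have "(m has_field_derivative deriv m z) (at z)"
        "(deriv m has_field_derivative deriv (deriv m) z) (at z)"
        using holm hol' that by (auto intro: holomorphic_derivI)
      then have "(M has_field_derivative - z * deriv (deriv m) z) (at z)"
        unfolding M_def[abs_def] by (auto intro!: derivative_eq_intros)
      then show ?thesis by (rule DERIV_imp_deriv)
    qed
    have "deriv (deriv M) 0 = deriv (\<lambda>z. - z * deriv (deriv m) z) 0"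
      using dM by (intro deriv_cong_ev eventually_nhds_in_open[of "ball 0 1", THEN eventually_mono]) auto
    also have "\<dots> = - deriv (deriv m) 0"
    proof (rule DERIV_imp_deriv)
      have "(deriv (deriv m) has_field_derivative deriv (deriv (deriv m)) 0) (at 0)"
        using hol' by (auto intro: holomorphic_derivI)
      then show "((\<lambda>z. - z * deriv (deriv m) z) has_field_derivative - deriv (deriv m) 0) (at 0)"
        by (auto intro!: derivative_eq_intros)
    qed
    finally show ?thesis by (simp add: b_def eval_nat_numeral)
  qed
  \<comment> \<open>\<open>A > 1\<close> keeps the annulus away from the unit circle, so that the
    Taylor remainder of \<open>m\<close> is controlled on all of it; \<open>A\<close> tends to 1 at
    the very end.\<close>
  have main: "B \<le> A ^ 4" if A: "1 < A" for A
  proof -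
    obtain c where "0 \<le> c" and c: "\<And>z. cmod z \<le> 1 / A \<Longrightarrow> cmod (m z - (1 + b * z\<^sup>2)) \<le> c * cmod z ^ 3"
      using holomorphic_taylor2[OF holm, of "1 / A"] A by (auto simp: m0 m1 b_def)
    \<comment> \<open>A lower bound for the area of the image against the area of the enclosing
      disc, both divided by \<open>pi\<close>. As \<open>Y\<close> tends to infinity the terms
      \<open>Y ^ 2\<close> cancel and \<open>B / A ^ 2 - A ^ 2 \<le> 0\<close> remains.\<close>
    have ineq: "(1 - B / Y ^ 4) * (Y\<^sup>2 - A\<^sup>2 + B * (1 / A\<^sup>2 - 1 / Y\<^sup>2)) \<le> (Y + 8 * c / Y\<^sup>2)\<^sup>2"
      if Y: "A < Y" "4 * cmod b \<le> Y" "8 * c \<le> Y" for Y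
    proof -
      define \<beta> where "\<beta> = b / Y\<^sup>2"
      define G where "G \<tau> = m (exp \<tau>) / exp \<tau>" for \<tau>
      define F where "F \<tau> = G \<tau> - \<beta> * cnj (G \<tau>)" for \<tau>
      define D where "D s t = - exp (- Complex s t) * M (exp (Complex s t))" for s t
      have "1 < Y" using A Y by simp
      then have "Y < Y\<^sup>2" by (simp add: power2_eq_square)
      then have \<beta>: "cmod \<beta> < 1" using Y \<open>1 < Y\<close> by (simp add: \<beta>_def norm_divide norm_power divide_less_eq)
      have \<beta>2: "(cmod \<beta>)\<^sup>2 = B / Y ^ 4" using \<open>1 < Y\<close> by (simp add: \<beta>_def B_def norm_divide norm_power power_divide)
      have "(cmod \<beta>)\<^sup>2 < 1" using \<beta> by (simp add: power_less_one_iff abs_square_less_1)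
      have R: "1 / Y < cmod (exp \<tau>)" "cmod (exp \<tau>) < 1 / A" if "- ln Y < Re \<tau>" "Re \<tau> < - ln A" for \<tau>
      proof -
        have "1 / Y = exp (- ln Y)" "1 / A = exp (- ln A)"
          using A \<open>1 < Y\<close> by (simp_all add: exp_minus inverse_eq_divide)
        then show "1 / Y < cmod (exp \<tau>)" "cmod (exp \<tau>) < 1 / A" using that by simp_all
      qed
      have neg: "s < 0" if "s \<le> - ln A" for s
        using that ln_gt_zero[OF A] by linarith
      then have lnA: "cmod (exp \<tau>) < 1" if "Re \<tau> \<le> - ln A" for \<tau>
        using that by simp
      have "integral {- ln Y..- ln A} (\<lambda>s. integral {0..2 * pi}
            (\<lambda>t. \<bar>(cmod (D s t))\<^sup>2 - (cmod (- \<beta> * cnj (D s t)))\<^sup>2\<bar>)) \<le> pi * (Y + 8 * c / Y\<^sup>2)\<^sup>2"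
      proof (rule area_image_le[where F = F])
        fix s t assume st: "- ln Y < s" "s < - ln A"
        have "exp (Complex s t) \<in> ball 0 1" using lnA[of "Complex s t"] st by simp
        then have "(m has_field_derivative deriv m (exp (Complex s t))) (at (exp (Complex s t)))"
          using holm by (auto intro: holomorphic_derivI)
        then have "(G has_field_derivative D s t) (at (Complex s t))"
          unfolding G_def[abs_def] D_def M_def
          by (auto intro!: derivative_eq_intros DERIV_chain2[of m] simp: field_simps exp_minus)
        then have G': "(G has_derivative (\<lambda>v. D s t * v)) (at (Complex s t))"
          by (simp add: has_field_derivative_def)
        then have "(F has_derivative (\<lambda>v. D s t * v - \<beta> * cnj (D s t * v))) (at (Complex s t))"
          unfolding F_def[abs_def] by (intro derivative_intros has_derivative_cnj)
        then show "(F has_derivative (\<lambda>v. D s t * v + - \<beta> * cnj (D s t) * cnj v)) (at (Complex s t))"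
          by (simp add: mult.assoc)
      next
        show "inj_on F {z. - ln Y < Re z \<and> Re z < - ln A \<and> 0 < Im z \<and> Im z < 2 * pi}"
        proof (rule inj_onI)
          fix u v assume u: "u \<in> {z. - ln Y < Re z \<and> Re z < - ln A \<and> 0 < Im z \<and> Im z < 2 * pi}"
            and v: "v \<in> {z. - ln Y < Re z \<and> Re z < - ln A \<and> 0 < Im z \<and> Im z < 2 * pi}" and "F u = F v"
          then have "G u - G v = \<beta> * cnj (G u - G v)" by (simp add: F_def algebra_simps)
          then have "cmod (G u - G v) = cmod \<beta> * cmod (G u - G v)" by (metis norm_mult complex_mod_cnj)
          then have "G u = G v" using \<beta> by (metis mult_cancel_right1 norm_eq_zero less_irrefl right_minus_eq)
          then have "exp u = exp v"
            using inj_onD[OF inj, of "exp u" "exp v"] lnA[of u] lnA[of v] u v by (simp add: G_def)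
          then show "u = v" using u v by (auto intro!: exp_complex_eqI[of u v])
        qed
      next
        fix \<tau> assume \<tau>: "- ln Y < Re \<tau>" "Re \<tau> < - ln A"
        define z where "z = exp \<tau>"
        define X where "X = 1 / cmod z"
        define e where "e = m z - (1 + b * z\<^sup>2)"
        have z: "z \<noteq> 0" "1 / Y < cmod z" "cmod z < 1 / A" using R[OF \<tau>] by (auto simp: z_def)
        have X: "A \<le> X" "X \<le> Y" "0 < X" "cmod z = 1 / X" "cmod b \<le> Y"
          using z A \<open>1 < Y\<close> Y by (auto simp: X_def field_simps)
        have zz: "z * cnj z = 1 / X\<^sup>2"
          by (simp add: X(4) power_divide flip: complex_norm_square)
        have czz: "cnj (1 / z) = z * X\<^sup>2"
          using zz z X by (simp add: field_simps)
        have "F \<tau> = (1 / z + b * z + e / z) - \<beta> * cnj (1 / z + b * z + e / z)"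
          using z by (simp add: F_def G_def e_def field_simps power2_eq_square flip: z_def)
        also have "\<dots> = (1 / z - \<beta> * cnj b * cnj z) + (b * z - \<beta> * cnj (1 / z)) + (e / z - \<beta> * cnj (e / z))"
          by (simp add: algebra_simps)
        also have "1 / z - \<beta> * cnj b * cnj z = (1 - B / (X\<^sup>2 * Y\<^sup>2)) / z"
          using z zz X \<open>1 < Y\<close> by (simp add: \<beta>_def B_def field_simps complex_norm_square del: of_real_power)
        \<comment> \<open>The coefficient vanishes on the circle \<open>X = Y\<close>; this is what
          determines \<open>\<beta>\<close>.\<close>
        also have "b * z - \<beta> * cnj (1 / z) = (1 - X\<^sup>2 / Y\<^sup>2) * (b * z)"
          unfolding czz by (simp add: \<beta>_def algebra_simps)
        finally have F: "F \<tau> = (1 - B / (X\<^sup>2 * Y\<^sup>2)) / z + (1 - X\<^sup>2 / Y\<^sup>2) * (b * z) + (e / z - \<beta> * cnj (e / z))" .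
        have "cmod ((1 - B / (X\<^sup>2 * Y\<^sup>2)) / z) \<le> X"
        proof -
          have "B \<le> Y\<^sup>2" "1 \<le> X\<^sup>2" using X A by (auto simp: B_def power_mono)
          then have "B \<le> X\<^sup>2 * Y\<^sup>2" using mult_mono[of 1 "X\<^sup>2" B "Y\<^sup>2"] by (simp add: B_def)
          then have "\<bar>1 - B / (X\<^sup>2 * Y\<^sup>2)\<bar> \<le> 1" using X \<open>1 < Y\<close> by (simp add: B_def)
          moreover have "cmod ((1 - B / (X\<^sup>2 * Y\<^sup>2)) / z) = \<bar>1 - B / (X\<^sup>2 * Y\<^sup>2)\<bar> * X"
            unfolding norm_divide X(4) by (metis (no_types) norm_of_real of_real_1 of_real_diff of_real_divide of_real_mult divide_divide_eq_right div_by_1 of_real_power)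
          ultimately show ?thesis using X by (simp add: mult_left_le_one_le)
        qed
        moreover have "cmod ((1 - X\<^sup>2 / Y\<^sup>2) * (b * z)) = cmod b * (1 / X - X / Y\<^sup>2)"
        proof -
          have "X\<^sup>2 / Y\<^sup>2 \<le> 1" using X \<open>1 < Y\<close> by (simp add: power_mono)
          then have "cmod (of_real (1 - X\<^sup>2 / Y\<^sup>2)) = 1 - X\<^sup>2 / Y\<^sup>2" unfolding norm_of_real by simp
          then have "cmod ((1 - X\<^sup>2 / Y\<^sup>2) * (b * z)) = (1 - X\<^sup>2 / Y\<^sup>2) * (cmod b * (1 / X))"
            by (simp add: norm_mult X(4))
          then show ?thesis using X by (simp add: field_simps power2_eq_square)
        qed
        moreover have "cmod (e / z - \<beta> * cnj (e / z)) \<le> 2 * c / X\<^sup>2"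
        proof -
          have "cmod (e / z) \<le> c / X\<^sup>2"
            using c[of z] z X by (simp add: e_def norm_divide X(4) field_simps eval_nat_numeral)
          moreover have "cmod (\<beta> * cnj (e / z)) \<le> cmod (e / z)"
            unfolding norm_mult complex_mod_cnj using \<beta> by (simp add: mult_left_le_one_le)
          ultimately show ?thesis
            using norm_triangle_ineq4[of "e / z" "\<beta> * cnj (e / z)"] by simp
        qed
        ultimately have "cmod (F \<tau>) \<le> X + cmod b * (1 / X - X / Y\<^sup>2) + 2 * c / X\<^sup>2"
          unfolding F by (intro norm_triangle_le add_mono) auto
        also have "\<dots> \<le> Y + 8 * c / Y\<^sup>2"
          using X A Y \<open>0 \<le> c\<close> by (intro near_ellipse_bound) auto
        finally show "cmod (F \<tau>) \<le> Y + 8 * c / Y\<^sup>2" .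
      next
        show "continuous_on ({- ln Y..- ln A} \<times> {0..2 * pi}) (\<lambda>(s, t). D s t)"
          unfolding D_def case_prod_unfold Complex_eq
          by (intro continuous_intros continuous_on_compose2[OF holomorphic_on_imp_continuous_on[OF holM]])
            (auto dest: neg)
        then show "continuous_on ({- ln Y..- ln A} \<times> {0..2 * pi}) (\<lambda>(s, t). - \<beta> * cnj (D s t))"
          unfolding case_prod_unfold by (intro continuous_intros)
      qed (use \<open>0 \<le> c\<close> \<open>1 < Y\<close> in auto)
      also have "(\<lambda>s t. \<bar>(cmod (D s t))\<^sup>2 - (cmod (- \<beta> * cnj (D s t)))\<^sup>2\<bar>)
          = (\<lambda>s t. (1 - B / Y ^ 4) * exp (- 2 * s) * (cmod (M (of_real (exp s) * cis t)))\<^sup>2)"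
      proof (intro ext)
        fix s t
        have "(cmod (D s t))\<^sup>2 = exp (- 2 * s) * (cmod (M (of_real (exp s) * cis t)))\<^sup>2"
          by (simp add: D_def norm_mult power_mult_distrib exp_eq_polar[of "Complex s t"] flip: exp_double)
        moreover have "\<bar>(cmod (D s t))\<^sup>2 - (cmod (- \<beta> * cnj (D s t)))\<^sup>2\<bar> = (1 - (cmod \<beta>)\<^sup>2) * (cmod (D s t))\<^sup>2"
        proof -
          have "(cmod (D s t))\<^sup>2 - (cmod (- \<beta> * cnj (D s t)))\<^sup>2 = (1 - (cmod \<beta>)\<^sup>2) * (cmod (D s t))\<^sup>2"
            by (simp add: norm_mult power_mult_distrib algebra_simps)
          then show ?thesis using \<open>(cmod \<beta>)\<^sup>2 < 1\<close> by (simp add: abs_mult)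
        qed
        ultimately show "\<bar>(cmod (D s t))\<^sup>2 - (cmod (- \<beta> * cnj (D s t)))\<^sup>2\<bar>
            = (1 - B / Y ^ 4) * exp (- 2 * s) * (cmod (M (of_real (exp s) * cis t)))\<^sup>2"
          by (simp add: \<beta>2)
      qed
      finally have upper: "integral {- ln Y..- ln A} (\<lambda>s. integral {0..2 * pi}
          (\<lambda>t. (1 - B / Y ^ 4) * exp (- 2 * s) * (cmod (M (of_real (exp s) * cis t)))\<^sup>2)) \<le> pi * (Y + 8 * c / Y\<^sup>2)\<^sup>2" .
      \<comment> \<open>\<open>p s\<close> is the Bessel lower bound for the integral over the
        circle of radius \<open>exp s\<close>, and \<open>P\<close> is an antiderivative of
        \<open>p\<close>.\<close>
      define P where "P s = (1 - B / Y ^ 4) * pi * (B * exp (2 * s) - exp (- 2 * s))" for s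
      define p where "p s = (1 - B / Y ^ 4) * exp (- 2 * s) * (2 * pi * (1 + B * exp s ^ 4))" for s
      have "(p has_integral P (- ln A) - P (- ln Y)) {- ln Y..- ln A}"
      proof (rule fundamental_theorem_of_calculus)
        show "- ln Y \<le> - ln A" using A Y by simp
        fix s :: real
        have "exp s ^ 4 = exp (2 * s) * exp (2 * s)" "exp (- 2 * s) * exp (2 * s) = 1"
          by (simp_all add: eval_nat_numeral flip: exp_add)
        then have "p s = (1 - B / Y ^ 4) * pi * (B * (2 * exp (2 * s)) - - 2 * exp (- 2 * s))"
          unfolding p_def by algebra
        moreover have "(P has_real_derivative (1 - B / Y ^ 4) * pi * (B * (2 * exp (2 * s)) - - 2 * exp (- 2 * s))) (at s)"
          unfolding P_def[abs_def] by (auto intro!: derivative_eq_intros)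
        ultimately show "(P has_vector_derivative p s) (at s within {- ln Y..- ln A})"
          by (simp add: has_real_derivative_iff_has_vector_derivative has_vector_derivative_at_within)
      qed
      then have "P (- ln A) - P (- ln Y) \<le> integral {- ln Y..- ln A} (\<lambda>s. integral {0..2 * pi}
          (\<lambda>t. (1 - B / Y ^ 4) * exp (- 2 * s) * (cmod (M (of_real (exp s) * cis t)))\<^sup>2))"
      proof (rule has_integral_le)
        have "continuous_on ({- ln Y..- ln A} \<times> cbox 0 (2 * pi))
            (\<lambda>(s, t). (1 - B / Y ^ 4) * exp (- 2 * s) * (cmod (M (of_real (exp s) * cis t)))\<^sup>2)"
          unfolding case_prod_unfold
          by (intro continuous_intros continuous_on_compose2[OF holomorphic_on_imp_continuous_on[OF holM]])
            (auto simp: norm_mult dest: neg)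
        from integral_continuous_on_param[OF this]
        show "((\<lambda>s. integral {0..2 * pi} (\<lambda>t. (1 - B / Y ^ 4) * exp (- 2 * s) * (cmod (M (of_real (exp s) * cis t)))\<^sup>2))
          has_integral integral {- ln Y..- ln A} (\<lambda>s. integral {0..2 * pi}
          (\<lambda>t. (1 - B / Y ^ 4) * exp (- 2 * s) * (cmod (M (of_real (exp s) * cis t)))\<^sup>2))) {- ln Y..- ln A}"
          by (intro integrable_integral integrable_continuous_interval) simp
      next
        fix s assume "s \<in> {- ln Y..- ln A}"
        then have "exp s < 1" using lnA[of "of_real s"] by simp
        then have "2 * pi * (1 + B * exp s ^ 4) \<le> integral {0..2 * pi} (\<lambda>t. (cmod (M (of_real (exp s) * cis t)))\<^sup>2)"
          using circle_mean_norm_ge[OF holM, of "exp s"] by (simp add: M0 M2 B_def)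
        moreover have "0 \<le> (1 - B / Y ^ 4) * exp (- 2 * s)"
          using \<open>(cmod \<beta>)\<^sup>2 < 1\<close> by (simp add: \<beta>2)
        ultimately show "p s \<le> integral {0..2 * pi} (\<lambda>t. (1 - B / Y ^ 4) * exp (- 2 * s) * (cmod (M (of_real (exp s) * cis t)))\<^sup>2)"
          unfolding p_def integral_mult_right by (rule mult_left_mono)
      qed
      also note upper
      also have "P (- ln A) - P (- ln Y) = pi * ((1 - B / Y ^ 4) * (Y\<^sup>2 - A\<^sup>2 + B * (1 / A\<^sup>2 - 1 / Y\<^sup>2)))"
      proof -
        have "exp (2 * - ln x) = 1 / x\<^sup>2" "exp (- 2 * - ln x) = x\<^sup>2" if "1 < x" for x :: real
          using that by (simp_all add: exp_minus inverse_eq_divide exp_double)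
        from this[OF A] this[OF \<open>1 < Y\<close>] show ?thesis
          unfolding P_def by (simp add: algebra_simps)
      qed
      finally show ?thesis by simp
    qed
    \<comment> \<open>\<open>f u\<close> is the left side minus the right side of
      \<open>ineq\<close> at \<open>Y = 1 / u\<close>. After \<open>1 / u ^ 2\<close> has cancelled
      it is a polynomial in \<open>u\<close>, so the limit of large \<open>Y\<close> is its value at
      0.\<close>
    define f where "f u = B * u ^ 4 * (A\<^sup>2 - B / A\<^sup>2 + B * u\<^sup>2) - A\<^sup>2 + B / A\<^sup>2 - 2 * B * u\<^sup>2 - 16 * c * u
        - 64 * c\<^sup>2 * u ^ 4" for u
    have "(f \<longlongrightarrow> f 0) (at_right 0)"
      unfolding f_def by (intro tendsto_intros)
    moreover have "eventually (\<lambda>u. f u \<le> 0) (at_right 0)"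
    proof -
      define d where "d = 1 / (A + 4 * cmod b + 8 * c + 1)"
      have "f u \<le> 0" if u: "0 < u" "u < d" for u
      proof -
        have "A + 4 * cmod b + 8 * c + 1 < 1 / u"
          using u A \<open>0 \<le> c\<close> by (simp add: d_def field_simps add_pos_nonneg)
        then have Y: "A < 1 / u" "4 * cmod b \<le> 1 / u" "8 * c \<le> 1 / u"
          using A \<open>0 \<le> c\<close> norm_ge_zero[of b] by linarith+
        have "f u = (1 - B / (1 / u) ^ 4) * ((1 / u)\<^sup>2 - A\<^sup>2 + B * (1 / A\<^sup>2 - 1 / (1 / u)\<^sup>2))
            - (1 / u + 8 * c / (1 / u)\<^sup>2)\<^sup>2"
          using u A by (simp add: f_def field_simps eval_nat_numeral)
        then show ?thesis using ineq[OF Y] by simp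
      qed
      moreover have "0 < d" using A \<open>0 \<le> c\<close> by (simp add: d_def add_pos_nonneg)
      ultimately show ?thesis unfolding eventually_at_right_field by blast
    qed
    ultimately have "f 0 \<le> 0"
      by (intro tendsto_upperbound) auto
    then show ?thesis using A by (simp add: f_def field_simps eval_nat_numeral)
  qed
  have "B \<le> 1 ^ 4"
  proof (rule tendsto_lowerbound)
    show "((\<lambda>A. A ^ 4) \<longlongrightarrow> 1 ^ 4) (at_right (1 :: real))" by (intro tendsto_intros)
    show "eventually (\<lambda>A. B \<le> A ^ 4) (at_right 1)"
      using main eventually_at_right_less[of 1] by (auto elim: eventually_mono)
  qed auto
  then have "cmod b \<le> 1" by (simp add: B_def abs_square_le_1)
  then show ?thesis by (simp add: b_def norm_divide)
qed

section \<open>Bieberbach's inequality and the Koebe quarter theorem\<close>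

lemma deriv_deriv_eqI:
  fixes f f' :: "complex \<Rightarrow> complex"
  assumes "open S" "x \<in> S" "\<And>z. z \<in> S \<Longrightarrow> (f has_field_derivative f' z) (at z)"
    and "(f' has_field_derivative d) (at x)"
  shows "deriv (deriv f) x = d"
proof -
  have "deriv (deriv f) x = deriv f' x"
    using assms by (intro deriv_cong_ev eventually_nhds_in_open[of S, THEN eventually_mono]) (auto intro: DERIV_imp_deriv)
  then show ?thesis using DERIV_imp_deriv[OF assms(4)] by simp
qed

text \<open>The area theorem is applied to \<open>1 / sqrt (f (z ^ 2))\<close> for normalised \<open>f\<close>.\<close>

theorem bieberbach_second_coefficient:
  fixes f :: "complex \<Rightarrow> complex"
  assumes holf: "f holomorphic_on ball 0 1" and inj: "inj_on f (ball 0 1)"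
  shows "cmod (deriv (deriv f) 0) \<le> 4 * cmod (deriv f 0)"
proof -
  define a where "a = deriv f 0"
  have "a \<noteq> 0"
    unfolding a_def using holomorphic_injective_imp_regular[OF holf _ inj, of 0] by simp
  have df: "(f has_field_derivative deriv f z) (at z)" if "z \<in> ball 0 1" for z
    using holf that by (auto intro: holomorphic_derivI)
  obtain k where holk: "k holomorphic_on ball 0 1"
    and k: "\<And>z. cmod z < 1 \<Longrightarrow> (f z - f 0) / a = z * k z" and k0: "deriv (\<lambda>z. (f z - f 0) / a) 0 = k 0"
    by (rule Schwarz3[of "\<lambda>z. (f z - f 0) / a" 1]) (use \<open>a \<noteq> 0\<close> in \<open>auto intro!: holomorphic_intros holf\<close>)
  have "((\<lambda>z. (f z - f 0) / a) has_field_derivative 1) (at 0)"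
    using df[of 0] \<open>a \<noteq> 0\<close> by (auto intro!: derivative_eq_intros simp: a_def)
  then have "k 0 = 1" using k0 DERIV_imp_deriv by metis
  have knz: "k z \<noteq> 0" if "z \<in> ball 0 1" for z
  proof (cases "z = 0")
    case False
    then have "f z \<noteq> f 0" using inj that by (auto simp: inj_on_def)
    then show ?thesis using k[of z] that \<open>a \<noteq> 0\<close> by auto
  qed (simp add: \<open>k 0 = 1\<close>)
  obtain q where holq: "q holomorphic_on ball 0 1" and q: "\<And>z. z \<in> ball 0 1 \<Longrightarrow> k z = q z ^ 2"
    using contractible_imp_holomorphic_sqrt[OF holk _ knz] convex_imp_contractible[OF convex_ball] by blast
  have qnz: "q z \<noteq> 0" if "z \<in> ball 0 1" for z using q knz that by force
  define n where "n z = q 0 / q z" for z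
  have holn: "n holomorphic_on ball 0 1"
    unfolding n_def by (intro holomorphic_intros holq qnz)
  have n0: "n 0 = 1" using qnz[of 0] by (simp add: n_def)
  have nnz: "n z \<noteq> 0" if "z \<in> ball 0 1" for z using qnz qnz[of 0] that by (simp add: n_def)
  have nk: "n z ^ 2 * k z = 1" if "z \<in> ball 0 1" for z
    using q[OF that] q[of 0] qnz[OF that] \<open>k 0 = 1\<close> by (simp add: n_def power_divide)
  \<comment> \<open>\<open>z / n (z ^ 2)\<close> is an odd square root of the normalised
    \<open>f (z ^ 2)\<close>, and \<open>m z / z\<close> is its reciprocal. As \<open>m\<close> is
    even, \<open>deriv m 0 = 0\<close>, and its second derivative at 0 is twice the first derivative
    of \<open>n\<close>.\<close>
  define m where "m z = n (z\<^sup>2)" for z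
  have sq: "z\<^sup>2 \<in> ball 0 1" if "z \<in> ball 0 1" for z :: complex
    using that by (simp add: norm_power power_less_one_iff abs_square_less_1)
  have holm: "m holomorphic_on ball 0 1"
    unfolding m_def using sq by (intro holomorphic_on_compose_gen[OF _ holn, unfolded o_def]) (auto intro!: holomorphic_intros)
  have dn: "(n has_field_derivative deriv n z) (at z)" if "z \<in> ball 0 1" for z
    using holn that by (auto intro: holomorphic_derivI)
  have dm: "(m has_field_derivative deriv n (z\<^sup>2) * (2 * z)) (at z)" if "z \<in> ball 0 1" for z
    unfolding m_def[abs_def] by (rule DERIV_chain2[where f = n and g = "\<lambda>z. z\<^sup>2", OF dn[OF sq[OF that]]])
      (auto intro!: derivative_eq_intros)
  have dn': "(deriv n has_field_derivative deriv (deriv n) 0) (at (0\<^sup>2))"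
    using holn by (auto intro!: holomorphic_derivI[of _ "ball 0 1"] holomorphic_deriv)
  have "((\<lambda>z. deriv n (z\<^sup>2) * (2 * z)) has_field_derivative 2 * deriv n 0) (at 0)"
  proof -
    have "((\<lambda>z. z\<^sup>2) has_field_derivative (0 :: complex)) (at 0)"
      by (auto intro!: derivative_eq_intros)
    from DERIV_chain2[where f = "deriv n" and g = "\<lambda>z. z\<^sup>2", OF dn' this]
    have "((\<lambda>z. deriv n (z\<^sup>2)) has_field_derivative 0) (at 0)" by simp
    then show ?thesis by (auto intro!: derivative_eq_intros)
  qed
  from deriv_deriv_eqI[OF open_ball[of 0 1] _ dm this]
  have m2: "deriv (deriv m) 0 = 2 * deriv n 0" by simp
  have "cmod ((deriv ^^ 2) m 0) \<le> 2"
  proof (rule area_theorem[OF holm])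
    show "m 0 = 1" by (simp add: m_def n0)
    show "deriv m 0 = 0" using DERIV_imp_deriv[OF dm[of 0]] by simp
    show "inj_on (\<lambda>z. m z / z) (ball 0 1 - {0})"
    proof (rule inj_onI)
      fix z w :: complex assume z: "z \<in> ball 0 1 - {0}" and w: "w \<in> ball 0 1 - {0}" and eq: "m z / z = m w / w"
      have rec: "(m u / u)\<^sup>2 = 1 / ((f (u\<^sup>2) - f 0) / a)" if "u \<in> ball 0 1 - {0}" for u
      proof -
        have u: "u\<^sup>2 \<in> ball 0 1" "u \<noteq> 0" using sq[of u] that by auto
        have "(n (u\<^sup>2))\<^sup>2 = 1 / k (u\<^sup>2)" using nk[OF u(1)] knz[OF u(1)] by (simp add: field_simps)
        then show ?thesis using k[of "u\<^sup>2"] u by (simp add: m_def power_divide)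
      qed
      have "f (z\<^sup>2) = f (w\<^sup>2)"
      proof -
        have "1 / ((f (z\<^sup>2) - f 0) / a) = 1 / ((f (w\<^sup>2) - f 0) / a)"
          using rec[OF z] rec[OF w] eq by metis
        then show ?thesis using \<open>a \<noteq> 0\<close> by simp
      qed
      then have "z\<^sup>2 = w\<^sup>2" using inj_onD[OF inj] sq z w by blast
      then consider "z = w" | "z = - w" using power2_eq_iff by blast
      then show "z = w"
      proof cases
        \<comment> \<open>\<open>m z / z\<close> is odd, so equal values at \<open>w\<close> and
          \<open>- w\<close> would be 0, but \<open>n\<close> has no zero.\<close>
        case 2
        then have "m w = 0" using eq w by (simp add: m_def divide_simps)
        then show ?thesis using nnz[OF sq] w by (auto simp: m_def)
      qed
    qed
  qed
  then have n1: "cmod (deriv n 0) \<le> 1" by (simp add: numeral_2_eq_2 m2 norm_mult)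
  have dk: "(k has_field_derivative deriv k z) (at z)" if "z \<in> ball 0 1" for z
    using holk that by (auto intro: holomorphic_derivI)
  \<comment> \<open>Differentiating \<open>n z ^ 2 * k z = 1\<close> at 0 carries the bound 1 on
    \<open>deriv n 0\<close> over to the bound 2 on \<open>deriv k 0\<close>; the last factor 2
    comes from the second derivative of \<open>z * k z\<close>.\<close>
  have "2 * deriv n 0 + deriv k 0 = 0"
  proof -
    have "((\<lambda>z. n z ^ 2 * k z) has_field_derivative 2 * deriv n 0 + deriv k 0) (at 0)"
      using dn[of 0] dk[of 0] n0 \<open>k 0 = 1\<close> by (auto intro!: derivative_eq_intros)
    moreover have "((\<lambda>z. n z ^ 2 * k z) has_field_derivative 0) (at 0)"
      by (rule has_field_derivative_transform_within_open[of "\<lambda>z. 1" _ _ "ball 0 1"]) (auto simp: nk)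
    ultimately show ?thesis by (rule DERIV_unique)
  qed
  then have "deriv k 0 = - 2 * deriv n 0" by (simp add: add_eq_0_iff)
  then have k1: "cmod (deriv k 0) \<le> 2" using n1 by (simp add: norm_mult)
  have fk: "f 0 + a * (z * k z) = f z" if "z \<in> ball 0 1" for z
    using \<open>a \<noteq> 0\<close> that by (simp flip: k)
  have "deriv (deriv f) 0 = a * (2 * deriv k 0)"
  proof (rule deriv_deriv_eqI)
    fix z :: complex assume z: "z \<in> ball 0 1"
    have "((\<lambda>z. f 0 + a * (z * k z)) has_field_derivative a * (k z + z * deriv k z)) (at z)"
      using dk[OF z] by (auto intro!: derivative_eq_intros simp: algebra_simps)
    then show "(f has_field_derivative a * (k z + z * deriv k z)) (at z)"
      by (rule has_field_derivative_transform_within_open[of _ _ _ "ball 0 1"])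
        (use z fk in auto)
  next
    have "(deriv k has_field_derivative deriv (deriv k) 0) (at 0)"
      using holk by (auto intro!: holomorphic_derivI[of _ "ball 0 1"] holomorphic_deriv)
    then show "((\<lambda>z. a * (k z + z * deriv k z)) has_field_derivative a * (2 * deriv k 0)) (at 0)"
      using dk[of 0] by (auto intro!: derivative_eq_intros)
  qed auto
  then show ?thesis
    using mult_left_mono[OF k1 norm_ge_zero[of a]] by (simp add: norm_mult flip: a_def)
qed

text \<open>Bieberbach's inequality for both \<open>f\<close> and a Moebius transform of \<open>f\<close> that sends \<open>w\<close> to infinity.\<close>

theorem koebe_quarter:
  fixes f :: "complex \<Rightarrow> complex"
  assumes holf: "f holomorphic_on ball 0 1" and inj: "inj_on f (ball 0 1)" and w: "w \<notin> f ` ball 0 1"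
  shows "cmod (deriv f 0) \<le> 4 * cmod (w - f 0)"
proof -
  define v where "v = w - f 0"
  define g where "g z = (f z - f 0) * v / (w - f z)" for z
  have nz: "w - f z \<noteq> 0" if "z \<in> ball 0 1" for z using w that by auto
  have "v \<noteq> 0" using nz[of 0] by (simp add: v_def)
  have holg: "g holomorphic_on ball 0 1"
    unfolding g_def by (intro holomorphic_intros holf nz)
  have "inj_on g (ball 0 1)"
  proof (rule inj_onI)
    fix x y :: complex assume x: "x \<in> ball 0 1" and y: "y \<in> ball 0 1" and "g x = g y"
    then have "(f x - f 0) * (w - f y) = (f y - f 0) * (w - f x)"
      using nz[OF x] nz[OF y] \<open>v \<noteq> 0\<close> by (simp add: g_def divide_simps)
    then have "(f x - f y) * v = 0" unfolding v_def by algebra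
    then show "x = y" using \<open>v \<noteq> 0\<close> inj_onD[OF inj _ x y] by simp
  qed
  from bieberbach_second_coefficient[OF holg this]
  have g2: "cmod (deriv (deriv g) 0) \<le> 4 * cmod (deriv g 0)" .
  have df: "(f has_field_derivative deriv f z) (at z)"
    and df': "(deriv f has_field_derivative deriv (deriv f) z) (at z)" if "z \<in> ball 0 1" for z
    using holf that by (auto intro!: holomorphic_derivI[of _ "ball 0 1"] holomorphic_deriv)
  have dg: "(g has_field_derivative v\<^sup>2 * deriv f z / (w - f z)\<^sup>2) (at z)" if "z \<in> ball 0 1" for z
    unfolding g_def[abs_def] using df[OF that] nz[OF that]
    by (auto intro!: derivative_eq_intros simp: power2_eq_square v_def algebra_simps)
  have g1: "deriv g 0 = deriv f 0"
    using DERIV_imp_deriv[OF dg[of 0]] \<open>v \<noteq> 0\<close> by (simp add: v_def)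
  have "((\<lambda>z. v\<^sup>2 * deriv f z / (w - f z)\<^sup>2) has_field_derivative
      (v\<^sup>2 * deriv (deriv f) 0 * (w - f 0)\<^sup>2 + v\<^sup>2 * deriv f 0 * (2 * (w - f 0) * deriv f 0)) / ((w - f 0)\<^sup>2 * (w - f 0)\<^sup>2)) (at 0)"
    using df[of 0] df'[of 0] nz[of 0] by (auto intro!: derivative_eq_intros simp: algebra_simps)
  also have "(v\<^sup>2 * deriv (deriv f) 0 * (w - f 0)\<^sup>2 + v\<^sup>2 * deriv f 0 * (2 * (w - f 0) * deriv f 0)) / ((w - f 0)\<^sup>2 * (w - f 0)\<^sup>2)
      = deriv (deriv f) 0 + 2 * (deriv f 0)\<^sup>2 / v"
    using \<open>v \<noteq> 0\<close> by (simp add: field_simps power2_eq_square flip: v_def)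
  finally have "deriv (deriv g) 0 = deriv (deriv f) 0 + 2 * (deriv f 0)\<^sup>2 / v"
    by (intro deriv_deriv_eqI[OF open_ball[of 0 1] _ dg]) auto
  then have "cmod (deriv (deriv f) 0 + 2 * (deriv f 0)\<^sup>2 / v) \<le> 4 * cmod (deriv f 0)"
    using g1 g2 by simp
  moreover have "cmod (deriv (deriv f) 0) \<le> 4 * cmod (deriv f 0)"
    by (rule bieberbach_second_coefficient[OF holf inj])
  \<comment> \<open>Here 8 is 4 + 4, one Bieberbach bound for \<open>g\<close> and one for
    \<open>f\<close>, which have the same derivative at 0.\<close>
  ultimately have "cmod (2 * (deriv f 0)\<^sup>2 / v) \<le> 8 * cmod (deriv f 0)"
    using norm_triangle_ineq4[of "deriv (deriv f) 0 + 2 * (deriv f 0)\<^sup>2 / v" "deriv (deriv f) 0"] by simp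
  then have "cmod (deriv f 0) * cmod (deriv f 0) \<le> cmod (deriv f 0) * (4 * cmod v)"
    using \<open>v \<noteq> 0\<close> by (simp add: norm_divide norm_mult norm_power field_simps power2_eq_square)
  moreover have "deriv f 0 \<noteq> 0"
    using holomorphic_injective_imp_regular[OF holf _ inj, of 0] by simp
  ultimately show ?thesis by (simp add: v_def mult_le_cancel_left)
qed

section \<open>The conformal radius\<close>

lemma Moebius_function_deriv:
  assumes "1 - cnj w * z \<noteq> 0"
  shows "(Moebius_function 0 w has_field_derivative (1 - w * cnj w) / (1 - cnj w * z)\<^sup>2) (at z)"
  unfolding Moebius_function_simple using assms
  by (auto intro!: derivative_eq_intros simp: field_simps power2_eq_square)

lemma one_minus_cnj_mult_nonzero:
  assumes "cmod w < 1" "cmod z < 1"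
  shows "1 - cnj w * z \<noteq> 0"
proof
  assume "1 - cnj w * z = 0"
  then have "cmod (cnj w * z) = 1" by (metis norm_one right_minus_eq)
  moreover have "cmod w * cmod z < 1 * 1" using assms by (intro mult_strict_mono') auto
  ultimately show False by (simp add: norm_mult)
qed

text \<open>Precomposition with a disc automorphism moves \<open>x\<close> to the centre and keeps
  the image, so inequalities at 0 become inequalities at any point. The automorphism has first
  derivative \<open>1 - \<bar>x\<bar> ^ 2\<close> and second derivative
  \<open>- 2 * cnj x * (1 - \<bar>x\<bar> ^ 2)\<close> at 0, which gives the last two formulas by
  the chain rule.\<close>

lemma koebe_transform:
  fixes h :: "complex \<Rightarrow> complex"
  assumes holh: "h holomorphic_on ball 0 1" and inj: "inj_on h (ball 0 1)" and x: "cmod x < 1"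
  defines "f \<equiv> \<lambda>z. h (Moebius_function 0 (- x) z)"
  shows "f holomorphic_on ball 0 1" "inj_on f (ball 0 1)" "f 0 = h x" "f ` ball 0 1 = h ` ball 0 1"
    "deriv f 0 = (1 - (cmod x)\<^sup>2) * deriv h x"
    "deriv (deriv f) 0 = (1 - (cmod x)\<^sup>2) * ((1 - (cmod x)\<^sup>2) * deriv (deriv h) x - 2 * cnj x * deriv h x)"
proof -
  let ?\<phi> = "Moebius_function 0 (- x)"
  have ball: "?\<phi> z \<in> ball 0 1" if "z \<in> ball 0 1" for z
    using Moebius_function_norm_lt_1[of "- x" z] that x by simp
  show "f holomorphic_on ball 0 1"
    unfolding f_def using ball x
    by (intro holomorphic_on_compose_gen[OF Moebius_function_holomorphic holh, unfolded o_def]) auto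
  have "h v \<in> f ` ball 0 1" if "v \<in> ball 0 1" for v
  proof (rule image_eqI)
    show "Moebius_function 0 x v \<in> ball 0 1"
      using Moebius_function_norm_lt_1[OF x, of v] that by simp
    show "h v = f (Moebius_function 0 x v)"
      using Moebius_function_compose[of "- x" x v] x that by (simp add: f_def)
  qed
  then show "f ` ball 0 1 = h ` ball 0 1" unfolding f_def using ball by blast
  show "inj_on f (ball 0 1)"
  proof (rule inj_onI)
    fix z w :: complex assume z: "z \<in> ball 0 1" and w: "w \<in> ball 0 1" and "f z = f w"
    then have "?\<phi> z = ?\<phi> w" using inj_onD[OF inj _ ball[OF z] ball[OF w]] by (simp add: f_def)
    then show "z = w" using Moebius_function_compose[of x "- x"] x z w by (metis mem_ball_0)
  qed
  have \<phi>0: "?\<phi> 0 = x" by (simp add: Moebius_function_simple)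
  then show "f 0 = h x" by (simp add: f_def)
  define c where "c = 1 - x * cnj x"
  have c: "c = 1 - (cmod x)\<^sup>2" using complex_norm_square[of x] by (simp add: c_def)
  have dh: "(h has_field_derivative deriv h z) (at z)"
    and dh': "(deriv h has_field_derivative deriv (deriv h) z) (at z)" if "z \<in> ball 0 1" for z
    using holh that by (auto intro!: holomorphic_derivI[of _ "ball 0 1"] holomorphic_deriv)
  have d\<phi>: "(?\<phi> has_field_derivative c / (1 + cnj x * z)\<^sup>2) (at z)" if "z \<in> ball 0 1" for z
    using Moebius_function_deriv[of "- x" z] one_minus_cnj_mult_nonzero[of "- x" z] that x
    by (simp add: c_def)
  have df: "(f has_field_derivative deriv h (?\<phi> z) * (c / (1 + cnj x * z)\<^sup>2)) (at z)" if "z \<in> ball 0 1" for z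
    unfolding f_def[abs_def] by (rule DERIV_chain2[where f = h, OF dh[OF ball[OF that]] d\<phi>[OF that]])
  from DERIV_imp_deriv[OF df[of 0]] show "deriv f 0 = (1 - (cmod x)\<^sup>2) * deriv h x"
    by (simp add: \<phi>0 c)
  have "((\<lambda>z. deriv h (?\<phi> z)) has_field_derivative deriv (deriv h) (?\<phi> 0) * (c / (1 + cnj x * 0)\<^sup>2)) (at 0)"
    by (rule DERIV_chain2[where f = "deriv h", OF dh'[OF ball] d\<phi>]) auto
  then have dh\<phi>: "((\<lambda>z. deriv h (?\<phi> z)) has_field_derivative deriv (deriv h) x * c) (at 0)"
    by (simp add: \<phi>0)
  have "((\<lambda>z. deriv h (?\<phi> z) * (c / (1 + cnj x * z)\<^sup>2)) has_field_derivative
      c * (c * deriv (deriv h) x - 2 * cnj x * deriv h x)) (at 0)"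
    using dh\<phi> by (auto intro!: derivative_eq_intros simp: \<phi>0 algebra_simps)
  from deriv_deriv_eqI[OF open_ball[of 0 1] _ df this]
  show "deriv (deriv f) 0 = (1 - (cmod x)\<^sup>2) * ((1 - (cmod x)\<^sup>2) * deriv (deriv h) x - 2 * cnj x * deriv h x)"
    by (simp add: c)
qed

definition conformal_radius :: "(complex \<Rightarrow> complex) \<Rightarrow> complex \<Rightarrow> real" where
  "conformal_radius h x = (1 - (cmod x)\<^sup>2) * cmod (deriv h x)"

lemma one_minus_norm_square_pos: "cmod x < 1 \<Longrightarrow> 0 < 1 - (cmod x)\<^sup>2"
  by (simp add: abs_square_less_1)

lemma norm_one_minus_norm_square: "cmod x < 1 \<Longrightarrow> cmod (1 - (complex_of_real (cmod x))\<^sup>2) = 1 - (cmod x)\<^sup>2"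
  using one_minus_norm_square_pos[of x] norm_of_real[of "1 - (cmod x)\<^sup>2", where 'a = complex] by simp

corollary koebe_quarter_at:
  fixes h :: "complex \<Rightarrow> complex" and x :: complex
  assumes "h holomorphic_on ball 0 1" "inj_on h (ball 0 1)" "cmod x < 1" "w \<notin> h ` ball 0 1"
  shows "conformal_radius h x \<le> 4 * cmod (w - h x)"
  using koebe_quarter[OF koebe_transform(1,2)[OF assms(1-3)], of w] koebe_transform(3-5)[OF assms(1-3)] assms(3,4)
  by (auto simp: conformal_radius_def norm_mult norm_one_minus_norm_square)

text \<open>The infinitesimal form of the Lipschitz bound: up to a factor, the expression on the
  left governs the change of \<open>conformal_radius h x\<close> when \<open>h x\<close>
  moves.\<close>

corollary bieberbach_at:
  fixes h :: "complex \<Rightarrow> complex" and x :: complex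
  assumes "h holomorphic_on ball 0 1" "inj_on h (ball 0 1)" "cmod x < 1"
  shows "cmod ((1 - (cmod x)\<^sup>2) * deriv (deriv h) x - 2 * cnj x * deriv h x) \<le> 4 * cmod (deriv h x)"
proof -
  from bieberbach_second_coefficient[OF koebe_transform(1,2)[OF assms]]
  have "(1 - (cmod x)\<^sup>2) * cmod ((1 - (cmod x)\<^sup>2) * deriv (deriv h) x - 2 * cnj x * deriv h x)
      \<le> (1 - (cmod x)\<^sup>2) * (4 * cmod (deriv h x))"
    unfolding koebe_transform(5,6)[OF assms] using assms(3) by (simp add: norm_mult norm_one_minus_norm_square mult_ac)
  then show ?thesis using one_minus_norm_square_pos[OF assms(3)] by (simp only: mult_le_cancel_left_pos)
qed

text \<open>Follow the conformal radius along the segment from \<open>h x\<close> to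
  \<open>w\<close> and bound its derivative by Bieberbach's inequality. The image need not be
  convex; the segment stays inside because, by the quarter theorem, every omitted value is at least
  a quarter of the conformal radius away from \<open>h x\<close>.\<close>

theorem conformal_radius_lipschitz:
  fixes h :: "complex \<Rightarrow> complex" and x :: complex
  assumes holh: "h holomorphic_on ball 0 1" and inj: "inj_on h (ball 0 1)" and x: "cmod x < 1"
    and w: "4 * cmod (w - h x) < conformal_radius h x"
  obtains y where "cmod y < 1" "h y = w"
    "conformal_radius h x - 4 * cmod (w - h x) \<le> conformal_radius h y"
proof -
  define d where "d = w - h x"
  define l where "l t = h x + of_real t * d" for t
  obtain g where holg: "g holomorphic_on h ` ball 0 1"
    and g': "\<And>z. z \<in> ball 0 1 \<Longrightarrow> deriv h z * deriv g (h z) = 1" and gh: "\<And>z. z \<in> ball 0 1 \<Longrightarrow> g (h z) = z"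
    using holomorphic_has_inverse[OF holh open_ball inj] by metis
  have "open (h ` ball 0 1)"
    using open_mapping_thm3[OF holh open_ball inj] .
  have l: "l t \<in> h ` ball 0 1" if "t \<in> {0..1}" for t
  proof (rule ccontr)
    assume "l t \<notin> h ` ball 0 1"
    then have "cmod d < cmod (l t - h x)"
      using koebe_quarter_at[OF holh inj x] w by (fastforce simp: d_def)
    moreover have "t * cmod d \<le> cmod d" using that by (simp add: mult_left_le_one_le)
    ultimately show False using that by (simp add: l_def norm_mult)
  qed
  define \<gamma> where "\<gamma> t = g (l t)" for t
  have \<gamma>: "cmod (\<gamma> t) < 1" "h (\<gamma> t) = l t" if t: "t \<in> {0..1}" for t
    using l[OF t] gh by (auto simp: \<gamma>_def)
  define \<psi> where "\<psi> t = conformal_radius h (\<gamma> t)" for t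
  have "norm (\<psi> 1 - \<psi> 0) \<le> (4 * cmod d) * norm (1 - 0 :: real)"
  proof (rule field_differentiable_bound)
    fix t :: real assume t: "t \<in> {0..1}"
    define a \<kappa> where "a = \<gamma> t" and "\<kappa> = deriv h a"
    have a: "cmod a < 1" using \<gamma>(1)[OF t] by (simp add: a_def)
    have "\<kappa> * deriv g (l t) = 1"
      using g'[of "\<gamma> t"] \<gamma>[OF t] by (simp add: \<kappa>_def a_def)
    then have "\<kappa> \<noteq> 0" and dg: "deriv g (l t) = 1 / \<kappa>"
      by (auto simp: eq_divide_eq mult.commute)
    have "(l has_vector_derivative d) (at t)"
      unfolding l_def by (auto intro!: derivative_eq_intros)
    moreover have "(g has_field_derivative 1 / \<kappa>) (at (l t))"
      using holomorphic_derivI[OF holg \<open>open (h ` ball 0 1)\<close> l[OF t]] dg by simp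
    ultimately have \<gamma>': "(\<gamma> has_vector_derivative d / \<kappa>) (at t)"
      unfolding \<gamma>_def[abs_def] using field_vector_diff_chain_at[of l d t g "1 / \<kappa>"] by (simp add: o_def)
    have "(deriv h has_field_derivative deriv (deriv h) a) (at (\<gamma> t))"
      using holh a unfolding a_def by (auto intro!: holomorphic_derivI[of _ "ball 0 1"] holomorphic_deriv)
    from field_vector_diff_chain_at[OF \<gamma>' this]
    have \<kappa>': "((\<lambda>t. deriv h (\<gamma> t)) has_vector_derivative d / \<kappa> * deriv (deriv h) a) (at t)"
      by (simp add: o_def)
    define D where "D = - (2 * (a \<bullet> (d / \<kappa>))) * cmod \<kappa> + (1 - (cmod a)\<^sup>2) * ((d / \<kappa> * deriv (deriv h) a) \<bullet> sgn \<kappa>)"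
    have "(\<psi> has_derivative (\<lambda>s. s * D)) (at t)"
    proof -
      have \<gamma>1: "(\<gamma> has_derivative (\<lambda>s. s *\<^sub>R (d / \<kappa>))) (at t)"
        using \<gamma>' by (simp add: has_vector_derivative_def)
      have "((\<lambda>t. cmod (deriv h (\<gamma> t))) has_derivative (\<lambda>s. (s *\<^sub>R (d / \<kappa> * deriv (deriv h) a)) \<bullet> sgn \<kappa>)) (at t)"
        using has_derivative_compose[OF \<kappa>'[unfolded has_vector_derivative_def] has_derivative_norm[of "deriv h (\<gamma> t)"]]
          \<open>\<kappa> \<noteq> 0\<close> by (simp add: \<kappa>_def a_def)
      then have "((\<lambda>t. (1 - \<gamma> t \<bullet> \<gamma> t) * cmod (deriv h (\<gamma> t))) has_derivative (\<lambda>s. s * D)) (at t)"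
        using \<gamma>1 by (auto intro!: derivative_eq_intros ext
          simp: D_def inner_commute algebra_simps power2_norm_eq_inner simp flip: a_def \<kappa>_def)
      then show ?thesis
        by (simp add: \<psi>_def[abs_def] conformal_radius_def power2_norm_eq_inner)
    qed
    then show "(\<psi> has_field_derivative D) (at t within {0..1})"
      unfolding mult.commute[of _ D] by (simp add: has_field_derivative_def has_derivative_at_withinI)
    \<comment> \<open>\<open>E\<close> is the expression of \<open>bieberbach_at\<close>. The
      product rule gives \<open>D\<close> as real inner products, which combine to the real part of
      \<open>E\<close> times a factor of modulus
      \<open>\<bar>d\<bar> / \<bar>\<kappa>\<bar>\<close>.\<close>
    define E where "E = (1 - (cmod a)\<^sup>2) * deriv (deriv h) a - 2 * cnj a * \<kappa>"
    have inner: "u \<bullet> v = Re (u * cnj v)" "u \<bullet> v = Re (v * cnj u)" for u v :: complex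
      by (simp_all add: inner_complex_def)
    have sgn: "cnj (sgn \<kappa>) = cmod \<kappa> / \<kappa>"
      using \<open>\<kappa> \<noteq> 0\<close> complex_norm_square[of \<kappa>] by (simp add: sgn_eq field_simps power2_eq_square)
    have "- (2 * Re u) * p + q * Re v = Re (- (2 * u) * of_real p + of_real q * v)" for u v p q
      by simp
    then have "D = Re (- (2 * (d / \<kappa> * cnj a)) * of_real (cmod \<kappa>) +
        of_real (1 - (cmod a)\<^sup>2) * (d / \<kappa> * deriv (deriv h) a * (of_real (cmod \<kappa>) / \<kappa>)))"
      unfolding D_def inner(2)[of a] inner(1)[of _ "sgn \<kappa>"] sgn .
    also have "- (2 * (d / \<kappa> * cnj a)) * of_real (cmod \<kappa>) +
        of_real (1 - (cmod a)\<^sup>2) * (d / \<kappa> * deriv (deriv h) a * (of_real (cmod \<kappa>) / \<kappa>)) = d * cmod \<kappa> / \<kappa>\<^sup>2 * E"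
      using \<open>\<kappa> \<noteq> 0\<close> by (simp add: E_def field_simps power2_eq_square)
    finally have "\<bar>D\<bar> \<le> cmod (d * cmod \<kappa> / \<kappa>\<^sup>2 * E)"
      using abs_Re_le_cmod by metis
    also have "\<dots> \<le> cmod d * cmod \<kappa> / (cmod \<kappa>)\<^sup>2 * (4 * cmod \<kappa>)"
      using bieberbach_at[OF holh inj a] unfolding norm_mult norm_divide norm_power
      by (intro mult_mono) (auto simp: E_def \<kappa>_def a_def norm_mult)
    also have "\<dots> = 4 * cmod d"
      using \<open>\<kappa> \<noteq> 0\<close> by (simp add: power2_eq_square)
    finally show "norm D \<le> 4 * cmod d" by simp
  qed auto
  moreover have "\<gamma> 0 = x" using gh x by (simp add: \<gamma>_def l_def)
  ultimately show ?thesis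
    using that[of "\<gamma> 1"] \<gamma>[of 1] by (simp add: l_def d_def \<psi>_def)
qed

section \<open>The flow of a spirallike function\<close>

text \<open>The conformal radius grows with the domain: after both base points have been moved to
  the centre, the Schwarz lemma applies to the inverse of \<open>H\<close> composed with
  \<open>F\<close>.\<close>

lemma conformal_radius_mono:
  fixes f h :: "complex \<Rightarrow> complex"
  assumes holf: "f holomorphic_on ball 0 1" and injf: "inj_on f (ball 0 1)"
    and holh: "h holomorphic_on ball 0 1" and injh: "inj_on h (ball 0 1)"
    and sub: "f ` ball 0 1 \<subseteq> h ` ball 0 1"
    and x: "cmod x < 1" and y: "cmod y < 1" and eq: "f x = h y"
  shows "conformal_radius f x \<le> conformal_radius h y"
proof -
  define F where "F z = f (Moebius_function 0 (- x) z)" for z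
  define H where "H z = h (Moebius_function 0 (- y) z)" for z
  note F = koebe_transform[OF holf injf x, folded F_def[abs_def]]
  note H = koebe_transform[OF holh injh y, folded H_def[abs_def]]
  obtain g where holg: "g holomorphic_on H ` ball 0 1"
    and g': "\<And>z. z \<in> ball 0 1 \<Longrightarrow> deriv H z * deriv g (H z) = 1" and gH: "\<And>z. z \<in> ball 0 1 \<Longrightarrow> g (H z) = z"
    using holomorphic_has_inverse[OF H(1) open_ball H(2)] by metis
  have FH: "F z \<in> H ` ball 0 1" if "z \<in> ball 0 1" for z
    using F(4) H(4) sub that by blast
  have "F 0 = H 0" using F(3) H(3) eq by (simp add: F_def H_def)
  have "norm (deriv (\<lambda>z. g (F z)) 0) \<le> 1"
  proof (rule Schwarz_Lemma(2)[where \<xi> = 0])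
    show "(\<lambda>z. g (F z)) holomorphic_on ball 0 1"
      by (rule holomorphic_on_compose_gen[OF F(1) holg, unfolded o_def]) (use FH in auto)
    show "g (F 0) = 0" using \<open>F 0 = H 0\<close> gH[of 0] by simp
    show "norm (g (F z)) < 1" if "norm z < 1" for z
      using FH[of z] gH that by force
  qed (auto simp: dist_norm)
  moreover have "deriv (\<lambda>z. g (F z)) 0 = deriv g (H 0) * deriv F 0"
  proof (rule DERIV_imp_deriv, rule DERIV_chain2[where f = g])
    show "(F has_field_derivative deriv F 0) (at 0)"
      using F(1) by (auto intro: holomorphic_derivI)
    show "(g has_field_derivative deriv g (H 0)) (at (F 0))"
      using holomorphic_derivI[OF holg open_mapping_thm3[OF H(1) open_ball H(2)] FH[of 0]]
      by (simp add: \<open>F 0 = H 0\<close>)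
  qed
  ultimately have "cmod (deriv g (H 0)) * cmod (deriv F 0) \<le> 1" by (simp add: norm_mult)
  moreover have "cmod (deriv H 0) * cmod (deriv g (H 0)) = 1"
    using g'[of 0] by (metis centre_in_ball norm_mult norm_one zero_less_one)
  ultimately have "cmod (deriv F 0) \<le> cmod (deriv H 0)"
    by (metis (no_types, opaque_lifting) mult.assoc mult.commute mult.right_neutral mult_left_mono norm_ge_zero)
  then show ?thesis
    using x y by (simp add: F(5) H(5) conformal_radius_def norm_mult norm_one_minus_norm_square)
qed

text \<open>The shift by \<open>d\<close> is made first, at a cost of \<open>4 * cmod d\<close>, and
  then the contraction. The contracted function maps into \<open>h(\<Delta>)\<close> and has exactly
  \<open>exp (- Re \<mu> * t)\<close> times the conformal radius, so monotonicity finishes.\<close>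

lemma spirallike_flow:
  assumes sp: "disc_spirallike \<mu> h" and x: "cmod x < 1" and t: "0 \<le> t"
    and d: "4 * cmod d < conformal_radius h x"
  obtains y where "cmod y < 1" "h y = exp (- \<mu> * of_real t) * (h x + d)"
    "exp (- Re \<mu> * t) * (conformal_radius h x - 4 * cmod d) \<le> conformal_radius h y"
proof -
  have holh: "h holomorphic_on ball 0 1" and inj: "inj_on h (ball 0 1)"
    and sub: "(\<lambda>w. exp (- \<mu> * of_real t) * w) ` h ` ball 0 1 \<subseteq> h ` ball 0 1"
    using sp t by (auto simp: disc_spirallike_def)
  obtain u where u: "cmod u < 1" "h u = h x + d"
    and ru: "conformal_radius h x - 4 * cmod d \<le> conformal_radius h u"
    using conformal_radius_lipschitz[OF holh inj x, of "h x + d"] d by auto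
  define f where "f z = exp (- \<mu> * of_real t) * h z" for z
  have "f u \<in> h ` ball 0 1" using sub u(1) unfolding f_def by fastforce
  then obtain y where y: "cmod y < 1" "h y = f u" by auto
  have "conformal_radius f u \<le> conformal_radius h y"
  proof (rule conformal_radius_mono)
    show "f holomorphic_on ball 0 1" unfolding f_def by (intro holomorphic_intros holh)
    show "inj_on f (ball 0 1)" using inj by (auto simp: f_def inj_on_def)
    show "f ` ball 0 1 \<subseteq> h ` ball 0 1" using sub unfolding f_def by (simp add: image_image)
  qed (use holh inj u y in auto)
  moreover have "(h has_field_derivative deriv h u) (at u)"
    using holh u by (auto intro: holomorphic_derivI)
  then have "deriv f u = exp (- \<mu> * of_real t) * deriv h u"
    unfolding f_def[abs_def] by (intro DERIV_imp_deriv DERIV_cmult)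
  then have "conformal_radius f u = exp (- Re \<mu> * t) * conformal_radius h u"
    by (simp add: conformal_radius_def norm_mult)
  ultimately have "exp (- Re \<mu> * t) * (conformal_radius h x - 4 * cmod d) \<le> conformal_radius h y"
    using mult_left_mono[OF ru exp_ge_zero[of "- Re \<mu> * t"]] by linarith
  then show ?thesis using that y u by (simp add: f_def)
qed

text \<open>Compare derivatives: \<open>\<nu> * exp (- \<nu> * s)\<close> has modulus
  \<open>cmod \<nu> * exp (- Re \<nu> * s)\<close>, which is the derivative of the right side. Both
  sides vanish at 0.\<close>

lemma norm_one_minus_exp_le:
  assumes "0 < Re \<nu>" "0 \<le> s"
  shows "cmod (1 - exp (- \<nu> * of_real s)) \<le> cmod \<nu> / Re \<nu> * (1 - exp (- Re \<nu> * s))"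
proof (cases "s = 0")
  case False
  then have "norm ((1 - exp (- \<nu> * of_real s)) - (1 - exp (- \<nu> * of_real 0)))
      \<le> cmod \<nu> / Re \<nu> * (1 - exp (- Re \<nu> * s)) - cmod \<nu> / Re \<nu> * (1 - exp (- Re \<nu> * 0))"
  proof (intro differentiable_bound_general)
    show "0 < s" using False assms by simp
    fix t :: real
    have "((\<lambda>z. 1 - exp (- \<nu> * z)) has_field_derivative \<nu> * exp (- \<nu> * of_real t)) (at (of_real t))"
      by (auto intro!: derivative_eq_intros)
    from has_vector_derivative_real_field[OF this]
    show "((\<lambda>t. 1 - exp (- \<nu> * of_real t)) has_vector_derivative \<nu> * exp (- \<nu> * of_real t)) (at t)" .
    have "((\<lambda>t. cmod \<nu> / Re \<nu> * (1 - exp (- Re \<nu> * t))) has_real_derivative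
        cmod \<nu> / Re \<nu> * (Re \<nu> * exp (- Re \<nu> * t))) (at t)"
      by (auto intro!: derivative_eq_intros)
    then show "((\<lambda>t. cmod \<nu> / Re \<nu> * (1 - exp (- Re \<nu> * t))) has_vector_derivative
        cmod \<nu> / Re \<nu> * (Re \<nu> * exp (- Re \<nu> * t))) (at t)"
      by (simp only: has_real_derivative_iff_has_vector_derivative)
    show "norm (\<nu> * exp (- \<nu> * of_real t)) \<le> cmod \<nu> / Re \<nu> * (Re \<nu> * exp (- Re \<nu> * t))"
      using assms by (simp add: norm_mult)
  qed (use assms in \<open>auto intro!: continuous_intros\<close>)
  then show ?thesis by simp
qed simp

section \<open>Complex differentiability in Banach spaces\<close>

lemma scaleC_zero_right [simp]: "a *\<^sub>C (0 :: 'a::complex_vector) = 0"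
  using scaleC_add_right[of a 0 "0 :: 'a"] by simp

lemma scaleC_minus_right: "a *\<^sub>C (- x :: 'a::complex_vector) = - (a *\<^sub>C x)"
  using scaleC_add_right[of a x "- x"] by (simp add: eq_neg_iff_add_eq_0 add.commute)

lemma scaleC_diff_left: "(a - b) *\<^sub>C (x :: 'a::complex_vector) = a *\<^sub>C x - b *\<^sub>C x"
  using scaleC_add_left[of "a - b" b x] by (simp add: eq_diff_eq)

lemma bounded_bilinear_scaleC:
  "bounded_bilinear (scaleC :: complex \<Rightarrow> 'a \<Rightarrow> 'a::complex_normed_vector)"
proof
  show "\<exists>K. \<forall>a b. norm (a *\<^sub>C (b :: 'a)) \<le> norm a * norm b * K"
    by (rule exI[of _ 1]) (simp add: norm_scaleC)
qed (simp_all add: scaleC_add_left scaleC_add_right scaleR_scaleC scaleC_scaleC scaleC_complex_def mult.commute)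

lemma bounded_clinearI:
  assumes "\<And>x y. f (x + y) = f x + f y" "\<And>c x. f (c *\<^sub>C x) = c *\<^sub>C f x" "\<And>x. norm (f x) \<le> norm x * K"
  shows "bounded_clinear f"
  unfolding bounded_clinear_def clinear_def
  using assms by (auto intro!: bounded_linear_intro[of f K] simp: scaleR_scaleC)

lemma bounded_clinear_add:
  "bounded_clinear f \<Longrightarrow> bounded_clinear g \<Longrightarrow> bounded_clinear (\<lambda>x. f x + g x)"
  unfolding bounded_clinear_def clinear_def
  by (auto simp: scaleC_add_right bounded_linear_add algebra_simps)

lemma bounded_clinear_sum:
  assumes "\<And>i. i \<in> A \<Longrightarrow> bounded_clinear (f i)"
  shows "bounded_clinear (\<lambda>x. \<Sum>i\<in>A. f i x)"
  using assms
proof (induction A rule: infinite_finite_induct)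
  case (insert i A)
  then show ?case by (simp add: bounded_clinear_add)
qed (auto intro: bounded_clinearI[where K = 0])

text \<open>Complex differentiability at a single point, so that sums, products and compositions can
  be formed without carrying domains along.\<close>

definition frechet_at :: "('a::complex_normed_vector \<Rightarrow> 'b::complex_normed_vector) \<Rightarrow> 'a \<Rightarrow> bool" where
  "frechet_at f x \<longleftrightarrow> (\<exists>f'. bounded_clinear f' \<and> (f has_derivative f') (at x))"

lemma frechet_atI: "bounded_clinear f' \<Longrightarrow> (f has_derivative f') (at x) \<Longrightarrow> frechet_at f x"
  unfolding frechet_at_def by blast

lemma frechet_at_imp_isCont: "frechet_at f x \<Longrightarrow> isCont f x"
  unfolding frechet_at_def by (auto intro: has_derivative_continuous)

lemma frechet_at_bounded_clinear: "bounded_clinear f \<Longrightarrow> frechet_at f x"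
  by (rule frechet_atI, assumption) (simp add: bounded_clinear_def bounded_linear_imp_has_derivative)

lemma frechet_at_compose:
  assumes "frechet_at f x" "frechet_at g (f x)"
  shows "frechet_at (\<lambda>x. g (f x)) x"
proof -
  obtain f' g' where f': "bounded_clinear f'" "(f has_derivative f') (at x)"
    and g': "bounded_clinear g'" "(g has_derivative g') (at (f x))"
    using assms unfolding frechet_at_def by blast
  have "bounded_linear (\<lambda>h. g' (f' h))"
    using f' g' unfolding bounded_clinear_def by (blast intro: bounded_linear_compose)
  then show ?thesis
    using f' g' by (intro frechet_atI[OF _ has_derivative_compose[OF f'(2) g'(2)]])
      (simp add: bounded_clinear_def clinear_def)
qed

lemma frechet_at_add:
  "frechet_at f x \<Longrightarrow> frechet_at g x \<Longrightarrow> frechet_at (\<lambda>x. f x + g x) x"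
  unfolding frechet_at_def by (blast intro: bounded_clinear_add has_derivative_add)

lemma frechet_at_minus:
  assumes "frechet_at f x"
  shows "frechet_at (\<lambda>x. - f x) x"
  by (rule frechet_at_compose[OF assms], rule frechet_at_bounded_clinear, rule bounded_clinearI[of _ 1])
    (simp_all add: scaleC_minus_right)

lemma frechet_at_Pair:
  assumes "frechet_at f x" "frechet_at g x"
  shows "frechet_at (\<lambda>x. (f x, g x)) x"
proof -
  obtain f' g' where f': "bounded_clinear f'" "(f has_derivative f') (at x)"
    and g': "bounded_clinear g'" "(g has_derivative g') (at x)"
    using assms unfolding frechet_at_def by blast
  then show ?thesis
    by (intro frechet_atI[OF _ has_derivative_Pair[OF f'(2) g'(2)]])
      (simp add: bounded_clinear_def clinear_def scaleC_prod_def bounded_linear_Pair)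
qed

lemma frechet_at_fst: "frechet_at f x \<Longrightarrow> frechet_at (\<lambda>x. fst (f x)) x"
  by (erule frechet_at_compose, rule frechet_at_bounded_clinear)
    (simp add: bounded_clinear_def clinear_def scaleC_prod_def bounded_linear_fst)

lemma frechet_at_snd: "frechet_at f x \<Longrightarrow> frechet_at (\<lambda>x. snd (f x)) x"
  by (erule frechet_at_compose, rule frechet_at_bounded_clinear)
    (simp add: bounded_clinear_def clinear_def scaleC_prod_def bounded_linear_snd)

lemma frechet_at_id: "frechet_at (\<lambda>x. x) x"
  by (rule frechet_at_bounded_clinear) (simp add: bounded_clinear_def clinear_def bounded_linear_ident)

lemma frechet_at_scaleC:
  assumes "frechet_at f x" "frechet_at g x"
  shows "frechet_at (\<lambda>x. f x *\<^sub>C g x) x"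
proof -
  interpret bounded_bilinear "scaleC :: complex \<Rightarrow> 'b \<Rightarrow> 'b" by (rule bounded_bilinear_scaleC)
  obtain f' g' where f': "bounded_clinear f'" "(f has_derivative f') (at x)"
    and g': "bounded_clinear g'" "(g has_derivative g') (at x)"
    using assms unfolding frechet_at_def by blast
  have "bounded_linear (\<lambda>h. f x *\<^sub>C g' h + f' h *\<^sub>C g x)"
    using f' g' unfolding bounded_clinear_def
    by (intro bounded_linear_add bounded_linear_compose[OF bounded_linear_right] bounded_linear_compose[OF bounded_linear_left]) auto
  moreover have "clinear (\<lambda>h. f x *\<^sub>C g' h + f' h *\<^sub>C g x)"
    using f' g' unfolding bounded_clinear_def clinear_def
    by (simp add: scaleC_add_right scaleC_add_left scaleC_scaleC scaleC_complex_def mult.commute)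
  ultimately show ?thesis
    by (intro frechet_atI[OF _ FDERIV[OF f'(2) g'(2)]]) (simp add: bounded_clinear_def)
qed

lemma frechet_at_holomorphic:
  assumes "h holomorphic_on S" "open S" "z \<in> S"
  shows "frechet_at h z"
proof (rule frechet_atI)
  show "(h has_derivative (\<lambda>v. deriv h z * v)) (at z)"
    using holomorphic_derivI[OF assms] by (simp add: has_field_derivative_def)
  show "bounded_clinear (\<lambda>v. deriv h z * v)"
    by (rule bounded_clinearI[of _ "cmod (deriv h z)"]) (simp_all add: algebra_simps scaleC_complex_def norm_mult)
qed

lemma frechet_at_transform_open:
  assumes "frechet_at f x" "open S" "x \<in> S" "\<And>y. y \<in> S \<Longrightarrow> f y = g y"
  shows "frechet_at g x"
  using assms unfolding frechet_at_def by (metis has_derivative_transform_within_open)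

text \<open>On the open image an explicit left inverse \<open>K\<close> agrees with
  \<open>inv_into\<close>, so differentiability passes from one to the other.\<close>

lemma biholomorphic_on_imageI:
  assumes "domain_in D" and G: "\<And>v. v \<in> D \<Longrightarrow> frechet_at G v"
    and K: "\<And>v. v \<in> D \<Longrightarrow> K (G v) = v"
    and op: "open (G ` D)" and K': "\<And>w. w \<in> G ` D \<Longrightarrow> frechet_at K w"
  shows "biholomorphic_on_image D G"
proof -
  have inj: "inj_on G D" using K by (metis inj_onI)
  have "frechet_at (inv_into D G) w" if "w \<in> G ` D" for w
    by (rule frechet_at_transform_open[OF K'[OF that] op that]) (use K inj in \<open>auto simp: inv_into_f_f\<close>)
  then show ?thesis
    using assms(1) G op inj
    by (auto simp: biholomorphic_on_image_def frechet_holomorphic_on_def domain_in_def frechet_at_def)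
qed

section \<open>Homogeneous polynomials: differentiability, scaling and norm\<close>

text \<open>The arguments \<open>b\<close> are replaced by \<open>a\<close> one slot after another;
  by linearity in slot \<open>i\<close>, each replacement adds a term with \<open>a i - b i\<close>
  in that slot.\<close>

lemma bounded_multilinear_telescope:
  assumes "bounded_multilinear r L" "k \<le> r"
  shows "L (\<lambda>i. if i < k then a i else b i) =
    L b + (\<Sum>i<k. L (\<lambda>j. if j < i then a j else if j = i then a i - b i else b j))"
  using assms(2)
proof (induction k)
  case (Suc k)
  let ?v = "\<lambda>i. if i < k then a i else b i"
  have lin: "clinear (\<lambda>u. L (?v(k := u)))"
    using assms(1) Suc.prems by (simp add: bounded_multilinear_def)
  have "(\<lambda>i. if i < Suc k then a i else b i) = ?v(k := (a k - b k) + b k)" by (auto simp: less_Suc_eq)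
  then have "L (\<lambda>i. if i < Suc k then a i else b i) = L (?v(k := a k - b k)) + L (?v(k := b k))"
    using lin unfolding clinear_def by presburger
  also have "?v(k := b k) = ?v" by auto
  also have "?v(k := a k - b k) = (\<lambda>j. if j < k then a j else if j = k then a k - b k else b j)" by auto
  finally show ?case using Suc by simp
qed simp

lemma bounded_multilinear_homogeneous:
  assumes "bounded_multilinear r L"
  shows "L (\<lambda>i. c *\<^sub>C y) = c ^ r *\<^sub>C L (\<lambda>_. y)"
proof -
  have "L (\<lambda>i. if i < k then c *\<^sub>C y else y) = c ^ k *\<^sub>C L (\<lambda>_. y)" if "k \<le> r" for k
    using that
  proof (induction k)
    case (Suc k)
    let ?v = "\<lambda>i. if i < k then c *\<^sub>C y else y"
    have "clinear (\<lambda>u. L (?v(k := u)))"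
      using assms Suc.prems by (simp add: bounded_multilinear_def)
    moreover have "(\<lambda>i. if i < Suc k then c *\<^sub>C y else y) = ?v(k := c *\<^sub>C y)" by (auto simp: less_Suc_eq)
    moreover have "?v(k := y) = ?v" by auto
    ultimately have "L (\<lambda>i. if i < Suc k then c *\<^sub>C y else y) = c *\<^sub>C L ?v"
      unfolding clinear_def by metis
    then show ?case using Suc by (simp add: scaleC_scaleC)
  qed (simp add: scaleC_one)
  from this[of r] have "c ^ r *\<^sub>C L (\<lambda>_. y) = L (\<lambda>i. if i < r then c *\<^sub>C y else y)" by simp
  also have "\<dots> = L (\<lambda>i. c *\<^sub>C y)"
    using assms by (auto simp: bounded_multilinear_def)
  finally show ?thesis ..
qed

text \<open>The derivative puts \<open>h\<close> into one slot and \<open>y\<close> into the others,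
  summed over the slots. Telescoping \<open>Q (y + h) - Q y\<close>, and then each resulting term
  against the matching term of \<open>D h\<close>, leaves only tuples with \<open>h\<close> in two
  different slots, which are quadratically small.\<close>

lemma homogeneous_polynomial_frechet_at:
  assumes "homogeneous_polynomial r Q"
  shows "frechet_at Q y"
proof -
  obtain L where L: "bounded_multilinear r L" and Q: "\<And>y. Q y = L (\<lambda>_. y)"
    using assms unfolding homogeneous_polynomial_def by blast
  have cong: "L u = L v" if "\<And>i. i < r \<Longrightarrow> u i = v i" for u v
    using L that by (auto simp: bounded_multilinear_def)
  obtain M0 where "\<And>v. norm (L v) \<le> M0 * (\<Prod>i<r. norm (v i))"
    using L unfolding bounded_multilinear_def by blast
  then have M: "norm (L v) \<le> \<bar>M0\<bar> * (\<Prod>i<r. norm (v i))" for v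
    by (rule order.trans) (simp add: mult_right_mono prod_nonneg)
  define M where "M = \<bar>M0\<bar>"
  \<comment> \<open>\<open>K\<close> bounds \<open>norm y\<close> and, for
    \<open>norm h \<le> 1\<close>, also \<open>norm (y + h)\<close>; being at least 1, it may also
    be multiplied to the slots that hold \<open>h\<close>.\<close>
  define K where "K = norm y + 1"
  have K: "1 \<le> K" by (simp add: K_def)
  define D where "D h = (\<Sum>i<r. L ((\<lambda>_. y)(i := h)))" for h
  have bound1: "norm (L ((\<lambda>_. y)(i := h))) \<le> norm h * (M * K ^ r)" if "i < r" for i h
  proof -
    have "(\<Prod>j<r. norm (((\<lambda>_. y)(i := h)) j)) \<le> (\<Prod>j<r. (if j = i then norm h else 1) * K)"
      using K by (intro prod_mono) (auto simp: K_def mult_left_mono mult_le_cancel_left1)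
    also have "\<dots> = norm h * K ^ r" using that by (simp add: prod.distrib)
    finally have "M * (\<Prod>j<r. norm (((\<lambda>_. y)(i := h)) j)) \<le> M * (norm h * K ^ r)"
      by (intro mult_left_mono) (simp_all add: M_def)
    then show ?thesis using M[of "(\<lambda>_. y)(i := h)"] by (simp add: M_def mult_ac)
  qed
  have "bounded_clinear D"
    unfolding D_def
  proof (intro bounded_clinear_sum bounded_clinearI)
    fix i assume "i \<in> {..<r}"
    then have "clinear (\<lambda>u. L ((\<lambda>_. y)(i := u)))" using L by (simp add: bounded_multilinear_def)
    then show "L ((\<lambda>_. y)(i := u + v)) = L ((\<lambda>_. y)(i := u)) + L ((\<lambda>_. y)(i := v))"
      "L ((\<lambda>_. y)(i := c *\<^sub>C u)) = c *\<^sub>C L ((\<lambda>_. y)(i := u))" for u v c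
      by (auto simp: clinear_def)
  qed (use bound1 in auto)
  moreover have "(Q has_derivative D) (at y)"
  proof (rule has_derivativeI_sandwich[of 1])
    show "bounded_linear D" using \<open>bounded_clinear D\<close> by (simp add: bounded_clinear_def)
    fix z assume "z \<noteq> y" "dist z y < 1"
    define h where "h = z - y"
    have h: "0 < norm h" "norm h \<le> 1" using \<open>z \<noteq> y\<close> \<open>dist z y < 1\<close> by (auto simp: h_def dist_norm)
    have yh: "norm (y + h) \<le> K" using norm_triangle_ineq[of y h] h by (simp add: K_def)
    define a where "a i = (\<lambda>j. if j < i then y + h else if j = i then h else y)" for i :: nat
    have "Q z = L (\<lambda>i. if i < r then y + h else y)"
      unfolding Q by (rule cong) (simp add: h_def)
    also have "\<dots> = Q y + (\<Sum>i<r. L (a i))"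
      using bounded_multilinear_telescope[OF L order.refl, of "\<lambda>_. y + h" "\<lambda>_. y"]
      by (simp add: Q a_def cong: if_cong)
    finally have "Q z - Q y - D h = (\<Sum>i<r. L (a i) - L ((\<lambda>_. y)(i := h)))"
      by (simp add: D_def sum_subtractf)
    also have "norm \<dots> \<le> (\<Sum>i<r. real r * (M * (norm h * (norm h * K ^ r))))"
    proof (rule sum_norm_le)
      fix i assume "i \<in> {..<r}"
      then have "i < r" by simp
      define b where "b = (\<lambda>_. y)(i := h)"
      define e where "e l = (\<lambda>j. if j < l then a i j else if j = l then a i l - b l else b j)" for l
      have "L (a i) = L (\<lambda>j. if j < r then a i j else b j)" by (rule cong) simp
      also have "\<dots> = L b + (\<Sum>l<r. L (e l))"
        unfolding e_def by (rule bounded_multilinear_telescope[OF L order.refl])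
      finally have "norm (L (a i) - L b) \<le> (\<Sum>l<r. norm (L (e l)))"
        by (simp add: norm_sum)
      also have "\<dots> \<le> (\<Sum>l<r. M * (norm h * (norm h * K ^ r)))"
      proof (rule sum_mono)
        fix l assume "l \<in> {..<r}"
        then have "l < r" by simp
        have "(\<Prod>j<r. norm (e l j)) \<le> norm h * (norm h * K ^ r)"
        proof (cases "l < i")
          case True
          have "(\<Prod>j<r. norm (e l j)) \<le> (\<Prod>j<r. (if j = i then norm h else 1) * ((if j = l then norm h else 1) * K))"
            using True K yh h by (intro prod_mono) (auto simp: e_def a_def b_def K_def mult_le_cancel_left1)
          also have "\<dots> = norm h * (norm h * K ^ r)"
            using \<open>i < r\<close> \<open>l < r\<close> by (simp add: prod.distrib)
          finally show ?thesis .
        next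
          case False
          then have "e l l = 0" by (simp add: e_def a_def b_def)
          then have "(\<Prod>j<r. norm (e l j)) = 0"
            using \<open>l < r\<close> by (intro prod_zero) auto
          moreover have "0 \<le> norm h * (norm h * K ^ r)" using K by simp
          ultimately show ?thesis by linarith
        qed
        then have "M * (\<Prod>j<r. norm (e l j)) \<le> M * (norm h * (norm h * K ^ r))"
          by (intro mult_left_mono) (simp_all add: M_def)
        with M[of "e l"] show "norm (L (e l)) \<le> M * (norm h * (norm h * K ^ r))"
          unfolding M_def by linarith
      qed
      finally show "norm (L (a i) - L ((\<lambda>_. y)(i := h))) \<le> real r * (M * (norm h * (norm h * K ^ r)))"
        by (simp add: b_def)
    qed
    also have "\<dots> = (real r * (real r * (M * K ^ r)) * norm h) * norm h" by simp
    finally show "norm ((Q z - Q y) - D (z - y)) / norm (z - y) \<le> real r * (real r * (M * K ^ r)) * norm (z - y)"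
      using h by (simp add: divide_le_eq flip: h_def)
  next
    have "((\<lambda>z. real r * (real r * (M * K ^ r)) * norm (z - y)) \<longlongrightarrow> real r * (real r * (M * K ^ r)) * norm (y - y)) (at y)"
      by (intro tendsto_intros)
    then show "((\<lambda>z. real r * (real r * (M * K ^ r)) * norm (z - y)) \<longlongrightarrow> 0) (at y)" by simp
  qed simp
  ultimately show ?thesis by (rule frechet_atI)
qed

lemma homogeneous_polynomial_scaleC:
  fixes Q :: "'a::complex_normed_vector \<Rightarrow> complex"
  assumes "homogeneous_polynomial r Q"
  shows "Q (c *\<^sub>C y) = c ^ r * Q y"
  using assms bounded_multilinear_homogeneous unfolding homogeneous_polynomial_def
  by (metis scaleC_complex_def)

lemma homogeneous_polynomial_le_SUP:
  fixes Q :: "'a::complex_normed_vector \<Rightarrow> complex"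
  assumes Q: "homogeneous_polynomial r Q" and "r \<ge> 1"
  shows "cmod (Q y) \<le> (SUP y\<in>sphere 0 1. cmod (Q y)) * norm y ^ r"
proof -
  obtain L M where L: "\<And>v. norm (L v) \<le> M * (\<Prod>i<r. norm (v i))" and QL: "\<And>y. Q y = L (\<lambda>_. y)"
    using Q unfolding homogeneous_polynomial_def bounded_multilinear_def by blast
  have M: "cmod (Q y) \<le> M * norm y ^ r" for y
    using L[of "\<lambda>_. y"] by (simp add: QL)
  show ?thesis
  proof (cases "y = 0")
    case True
    then show ?thesis using M[of 0] \<open>r \<ge> 1\<close> by (simp add: power_0_left)
  next
    case False
    define u where "u = complex_of_real (inverse (norm y)) *\<^sub>C y"
    have u: "u \<in> sphere 0 1" using False by (simp add: u_def norm_scaleC del: of_real_inverse)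
    have y: "y = complex_of_real (norm y) *\<^sub>C u"
      using False by (simp add: u_def scaleC_scaleC scaleC_one)
    \<comment> \<open>The multilinear bound makes the supremum a genuine one; over an unbounded set
      of reals its value would be unspecified.\<close>
    have "bdd_above ((\<lambda>y. cmod (Q y)) ` sphere 0 1)"
    proof (rule bdd_aboveI2[of _ _ M])
      show "cmod (Q v) \<le> M" if "v \<in> sphere 0 1" for v
        using M[of v] that by simp
    qed
    then have "cmod (Q u) \<le> (SUP y\<in>sphere 0 1. cmod (Q y))" using u by (intro cSUP_upper)
    then have "norm y ^ r * cmod (Q u) \<le> norm y ^ r * (SUP y\<in>sphere 0 1. cmod (Q y))"
      by (intro mult_left_mono) auto
    moreover have "cmod (Q y) = norm y ^ r * cmod (Q u)"
      by (subst y, subst homogeneous_polynomial_scaleC[OF Q]) (simp add: norm_mult norm_power)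
    ultimately show ?thesis by (simp add: mult.commute)
  qed
qed

section \<open>Norming functionals\<close>

definition sublinear :: "('a::real_vector \<Rightarrow> real) \<Rightarrow> bool" where
  "sublinear p \<longleftrightarrow> (\<forall>x y. p (x + y) \<le> p x + p y) \<and> (\<forall>c\<ge>0. \<forall>x. p (c *\<^sub>R x) = c * p x)"

lemma sublinear_ge:
  assumes "sublinear p"
  shows "- p (- x) \<le> p x"
proof -
  have "p 0 = 0 * p 0" using assms unfolding sublinear_def by (metis order.refl scaleR_zero_left)
  moreover have "p (x + - x) \<le> p x + p (- x)" using assms unfolding sublinear_def by blast
  ultimately show ?thesis by simp
qed

text \<open>Serves both infima of the Hahn-Banach argument, over a ray and over a chain. For
  homogeneity an inequality is enough: applied to \<open>1 / c\<close> it yields its own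
  converse.\<close>

lemma sublinear_INF:
  fixes e :: "'i \<Rightarrow> 'a::real_vector \<Rightarrow> real"
  assumes ne: "I \<noteq> {}" and bdd: "\<And>x. bdd_below ((\<lambda>i. e i x) ` I)" and zero: "\<And>i. i \<in> I \<Longrightarrow> e i 0 = 0"
    and add: "\<And>i j. i \<in> I \<Longrightarrow> j \<in> I \<Longrightarrow> \<exists>k\<in>I. \<forall>x y. e k (x + y) \<le> e i x + e j y"
    and scale: "\<And>i c. i \<in> I \<Longrightarrow> 0 < c \<Longrightarrow> \<exists>k\<in>I. \<forall>x. e k (c *\<^sub>R x) \<le> c * e i x"
  shows "sublinear (\<lambda>x. INF i\<in>I. e i x)"
proof -
  define q where "q x = (INF i\<in>I. e i x)" for x
  have le: "q x \<le> e i x" if "i \<in> I" for i x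
    unfolding q_def by (rule cINF_lower[OF bdd that])
  have ge: "m \<le> q x" if "\<And>i. i \<in> I \<Longrightarrow> m \<le> e i x" for m x
    unfolding q_def by (rule cINF_greatest[OF ne that])
  have "q (x + y) \<le> q x + q y" for x y
  proof -
    have "q (x + y) - e j y \<le> e i x" if "i \<in> I" "j \<in> I" for i j
      using add[OF that] le[of _ "x + y"] by (smt (verit))
    then have "q (x + y) - e j y \<le> q x" if "j \<in> I" for j using ge that by blast
    then have "q (x + y) - q x \<le> q y" using ge[of "q (x + y) - q x" y] by (simp add: algebra_simps)
    then show ?thesis by simp
  qed
  moreover have "q (c *\<^sub>R x) = c * q x" if "0 \<le> c" for c x
  proof (cases "c = 0")
    case True
    have "q 0 = 0" using ne zero unfolding q_def by simp
    then show ?thesis using True by simp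
  next
    case False
    then have "0 < c" using that by simp
    have half: "q (d *\<^sub>R v) \<le> d * q v" if d: "0 < d" for d v
    proof -
      have "q (d *\<^sub>R v) / d \<le> e i v" if i: "i \<in> I" for i
      proof -
        obtain k where "k \<in> I" "e k (d *\<^sub>R v) \<le> d * e i v" using scale[OF i d] by blast
        then have "q (d *\<^sub>R v) \<le> d * e i v" using le[of k "d *\<^sub>R v"] by linarith
        then show ?thesis using d by (simp add: field_simps)
      qed
      then have "q (d *\<^sub>R v) / d \<le> q v" by (rule ge)
      then show ?thesis using d by (simp add: field_simps)
    qed
    from half[of "1 / c" "c *\<^sub>R x"] \<open>0 < c\<close> have "c * q x \<le> q (c *\<^sub>R x)" by (simp add: field_simps)
    with half[OF \<open>0 < c\<close>, of x] show ?thesis by simp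
  qed
  ultimately show ?thesis by (simp add: sublinear_def flip: q_def)
qed

text \<open>A minimal sublinear \<open>p\<close> is linear: \<open>lower_along p y\<close> is sublinear and below \<open>p\<close>, hence equals \<open>p\<close>,
  and then \<open>t = 1\<close> gives \<open>p x + p y \<le> p (x + y)\<close>.\<close>

definition lower_along :: "('a::real_vector \<Rightarrow> real) \<Rightarrow> 'a \<Rightarrow> 'a \<Rightarrow> real" where
  "lower_along p y x = (INF t\<in>{0..}. p (x + t *\<^sub>R y) - t * p y)"

lemma
  fixes p :: "'a::real_vector \<Rightarrow> real"
  assumes p: "sublinear p"
  shows sublinear_lower_along: "sublinear (lower_along p y)"
    and lower_along_le: "0 \<le> t \<Longrightarrow> lower_along p y x \<le> p (x + t *\<^sub>R y) - t * p y"
proof -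
  let ?e = "\<lambda>t x. p (x + t *\<^sub>R y) - t * p y"
  have add: "p (u + v) \<le> p u + p v" for u v using p by (simp add: sublinear_def)
  have scale: "0 \<le> c \<Longrightarrow> p (c *\<^sub>R u) = c * p u" for c u using p by (simp add: sublinear_def)
  have lb: "- p (- x) \<le> ?e t x" if "0 \<le> t" for x t
    using add[of "x + t *\<^sub>R y" "- x"] scale[OF that, of y] by simp
  have bdd: "bdd_below ((\<lambda>t. ?e t x) ` {0..})" for x
    by (rule bdd_belowI2[of _ "- p (- x)"]) (use lb in auto)
  show "0 \<le> t \<Longrightarrow> lower_along p y x \<le> ?e t x"
    unfolding lower_along_def by (rule cINF_lower[OF bdd]) simp
  have "sublinear (\<lambda>x. INF t\<in>{0..}. ?e t x)"
  proof (rule sublinear_INF)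
    fix s t :: real assume "s \<in> {0..}" "t \<in> {0..}"
    then have "s + t \<in> {0..}" by simp
    moreover have "?e (s + t) (u + v) \<le> ?e s u + ?e t v" for u v
      using add[of "u + s *\<^sub>R y" "v + t *\<^sub>R y"] by (simp add: algebra_simps)
    ultimately show "\<exists>k\<in>{0..}. \<forall>u v. ?e k (u + v) \<le> ?e s u + ?e t v" by blast
  next
    fix t c :: real assume "t \<in> {0..}" "0 < c"
    then have "c * t \<in> {0..}" by simp
    moreover have "?e (c * t) (c *\<^sub>R u) \<le> c * ?e t u" for u
      using scale[of c "u + t *\<^sub>R y"] \<open>0 < c\<close> by (simp add: algebra_simps)
    ultimately show "\<exists>k\<in>{0..}. \<forall>u. ?e k (c *\<^sub>R u) \<le> c * ?e t u" by blast
  qed (use bdd scale in auto)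
  then show "sublinear (lower_along p y)" by (simp add: lower_along_def[abs_def])
qed

text \<open>The Hahn-Banach theorem in its dominated form. Zorn's lemma is used with the order
  reversed: a chain of sublinear functions below \<open>p\<close> has a sublinear pointwise infimum,
  finite because each member is at least \<open>- p (- x)\<close> at \<open>x\<close>.\<close>

lemma sublinear_dominates_linear:
  fixes p :: "'a::real_vector \<Rightarrow> real"
  assumes p: "sublinear p"
  obtains f where "linear f" "\<And>x. f x \<le> p x"
proof -
  define A where "A = {q. sublinear q \<and> q \<le> p}"
  have "\<exists>m\<in>A. \<forall>q\<in>A. q \<le> m \<longrightarrow> q = m"
  proof (rule predicate_Zorn[where P = "\<lambda>a b. b \<le> a"])
    show "partial_order_on A (relation_of (\<lambda>a b. b \<le> a) A)"
      by (rule partial_order_on_relation_ofI) auto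
    fix C assume "C \<in> Chains (relation_of (\<lambda>a b. b \<le> a) A)"
    then have CA: "q \<in> A" and chain: "q \<le> q' \<or> q' \<le> q" if "q \<in> C" "q' \<in> C" for q q'
      using that by (auto simp: Chains_def relation_of_def)
    show "\<exists>u\<in>A. \<forall>a\<in>C. u \<le> a"
    proof (cases "C = {}")
      case True
      then show ?thesis using p by (auto simp: A_def)
    next
      case False
      define u where "u x = (INF q\<in>C. q x)" for x
      have sub: "sublinear q" "q x \<le> p x" if "q \<in> C" for q x
        using CA[OF that that] by (auto simp: A_def le_fun_def)
      have bdd: "bdd_below ((\<lambda>q. q x) ` C)" for x
      proof (rule bdd_belowI2[of _ "- p (- x)"])
        fix q assume "q \<in> C"
        then show "- p (- x) \<le> q x" using sub(2)[of q "- x"] sublinear_ge[OF sub(1), of q x] by linarith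
      qed
      have le: "u x \<le> q x" if "q \<in> C" for q x
        unfolding u_def by (rule cINF_lower[OF bdd that])
      have "sublinear u"
        unfolding u_def[abs_def]
      proof (rule sublinear_INF[OF False bdd])
        fix q assume q: "q \<in> C"
        have "q (0 *\<^sub>R 0) = 0 * q 0" using sub(1)[OF q] unfolding sublinear_def by blast
        then show "q 0 = 0" by simp
        show "\<exists>k\<in>C. \<forall>x. k (c *\<^sub>R x) \<le> c * q x" if "0 < c" for c
          using sub(1)[OF q] q that by (intro bexI[of _ q]) (auto simp: sublinear_def)
        fix q' assume q': "q' \<in> C"
        have "\<exists>k\<in>C. k \<le> q \<and> k \<le> q'" using chain[OF q q'] q q' by blast
        then obtain k where "k \<in> C" "k \<le> q" "k \<le> q'" by blast
        moreover have "k (x + y) \<le> k x + k y" for x y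
          using sub(1)[OF \<open>k \<in> C\<close>] by (simp add: sublinear_def)
        ultimately show "\<exists>k\<in>C. \<forall>x y. k (x + y) \<le> q x + q' y"
          by (meson add_mono le_funD order.trans)
      qed
      moreover have "u \<le> p"
        using False le sub(2) by (meson all_not_in_conv le_funI order.trans)
      ultimately show ?thesis using le by (auto simp: A_def le_fun_def)
    qed
  qed
  then obtain f where f: "sublinear f" "f \<le> p" and min: "\<And>q. sublinear q \<Longrightarrow> q \<le> f \<Longrightarrow> q = f"
    unfolding A_def by fastforce
  have add: "f (x + y) = f x + f y" for x y
  proof (rule antisym)
    show "f (x + y) \<le> f x + f y" using f by (simp add: sublinear_def)
    have "lower_along f y \<le> f"
      using lower_along_le[OF f(1), of 0] by (simp add: le_fun_def)
    then have "lower_along f y = f" using sublinear_lower_along[OF f(1)] min by blast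
    with lower_along_le[OF f(1), of 1 y x] show "f x + f y \<le> f (x + y)" by simp
  qed
  have "linear f"
  proof (rule linearI)
    fix c x
    have "f 0 = 0" using add[of 0 0] by simp
    then have neg: "f (- u) = - f u" for u using add[of u "- u"] by simp
    show "f (c *\<^sub>R x) = c *\<^sub>R f x"
    proof (cases "0 \<le> c")
      case False
      moreover have "f (d *\<^sub>R x) = d * f x" if "0 \<le> d" for d using f(1) that by (simp add: sublinear_def)
      ultimately have "f ((- c) *\<^sub>R x) = (- c) * f x" by (metis neg_0_le_iff_le linear)
      then show ?thesis using neg[of "c *\<^sub>R x"] by simp
    qed (use f in \<open>simp add: sublinear_def\<close>)
  qed (rule add)
  then show ?thesis using that f(2) by (simp add: le_fun_def)
qed

lemma norming_functional:
  fixes y :: "'a::complex_normed_vector"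
  assumes "norm y = 1"
  obtains \<phi> :: "'a \<Rightarrow> complex" where "clinear \<phi>" "\<And>x. cmod (\<phi> x) \<le> norm x" "\<phi> y = 1"
proof -
  have norm_sublinear: "sublinear (norm :: 'a \<Rightarrow> real)"
    by (simp add: sublinear_def norm_triangle_ineq)
  \<comment> \<open>Lowering the norm along \<open>- y\<close> forces the functional to attain its
    norm: \<open>t = 1\<close> gives \<open>p y \<le> norm (y - y) - norm (- y) = - 1\<close>. Hence
    \<open>- f\<close> is at least 1 at \<open>y\<close> and is still dominated by the norm.\<close>
  define p where "p = lower_along norm (- y)"
  obtain f where f: "linear f" "\<And>x. f x \<le> p x"
    using sublinear_dominates_linear[OF sublinear_lower_along[OF norm_sublinear, of "- y"]] unfolding p_def by blast
  have p: "p x \<le> norm x" for x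
    using lower_along_le[OF norm_sublinear, of 0 "- y" x] by (simp add: p_def)
  have "p y \<le> - 1"
    using lower_along_le[OF norm_sublinear, of 1 "- y" y] assms by (simp add: p_def)
  then have "f y \<le> - 1" using f(2)[of y] by linarith
  define g where "g x = - f x" for x
  have g: "linear g" unfolding g_def using f(1) by (rule linear_compose_neg)
  have g_le: "g x \<le> norm x" for x
    using f(2)[of "- x"] p[of "- x"] linear_neg[OF f(1), of x] by (simp add: g_def)
  have "g y = 1" using g_le[of y] \<open>f y \<le> - 1\<close> assms by (simp add: g_def)
  \<comment> \<open>The complex-linear functional whose real part is \<open>g\<close>.\<close>
  define \<phi> where "\<phi> x = Complex (g x) (- g (\<i> *\<^sub>C x))" for x
  have add: "\<phi> (x + z) = \<phi> x + \<phi> z" for x z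
    by (simp add: \<phi>_def scaleC_add_right linear_add[OF g] complex_eq_iff)
  have real: "\<phi> (complex_of_real c *\<^sub>C x) = c * \<phi> x" for c x
  proof -
    have "\<i> *\<^sub>C complex_of_real c *\<^sub>C x = c *\<^sub>R \<i> *\<^sub>C x"
      by (simp add: scaleR_scaleC scaleC_scaleC mult.commute)
    then show ?thesis
      using linear_scale[OF g, of c x] linear_scale[OF g, of c "\<i> *\<^sub>C x"]
      by (simp add: \<phi>_def complex_eq_iff scaleR_scaleC)
  qed
  have i: "\<phi> (\<i> *\<^sub>C x) = \<i> * \<phi> x" for x
  proof -
    have "\<i> *\<^sub>C \<i> *\<^sub>C x = - x"
      using scaleR_scaleC[of "- 1" x] by (simp add: scaleC_scaleC)
    then show ?thesis by (simp add: \<phi>_def complex_eq_iff linear_neg[OF g])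
  qed
  have scale: "\<phi> (c *\<^sub>C x) = c * \<phi> x" for c x
  proof -
    have "c *\<^sub>C x = complex_of_real (Re c) *\<^sub>C x + complex_of_real (Im c) *\<^sub>C \<i> *\<^sub>C x"
      using complex_eq[of c] by (simp add: scaleC_scaleC mult.commute flip: scaleC_add_left)
    then have "\<phi> (c *\<^sub>C x) = Re c * \<phi> x + Im c * (\<i> * \<phi> x)" by (simp only: add real i)
    also have "\<dots> = (Re c + \<i> * Im c) * \<phi> x" by (simp add: algebra_simps)
    finally show ?thesis by (simp flip: complex_eq)
  qed
  \<comment> \<open>Rotate \<open>x\<close> so that \<open>\<phi> x\<close> becomes real.\<close>
  have bound: "cmod (\<phi> x) \<le> norm x" for x
  proof (cases "\<phi> x = 0")
    case False
    define u where "u = cnj (sgn (\<phi> x))"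
    have "cmod u = 1" using False by (simp add: u_def norm_sgn)
    have "\<phi> (u *\<^sub>C x) = cmod (\<phi> x)"
      using False complex_norm_square[of "\<phi> x"]
      by (simp add: scale u_def sgn_eq field_simps power2_eq_square)
    then have "cmod (\<phi> x) = g (u *\<^sub>C x)" by (simp add: \<phi>_def complex_eq_iff)
    also have "\<dots> \<le> norm x" using g_le[of "u *\<^sub>C x"] \<open>cmod u = 1\<close> by (simp add: norm_scaleC)
    finally show ?thesis .
  qed simp
  have "\<phi> y = 1"
  proof -
    have "Re (\<phi> y) = 1" by (simp add: \<phi>_def \<open>g y = 1\<close>)
    moreover have "(Re (\<phi> y))\<^sup>2 + (Im (\<phi> y))\<^sup>2 \<le> 1"
      using power_mono[OF bound[of y], of 2] assms by (simp add: cmod_power2)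
    ultimately show ?thesis by (simp add: complex_eq_iff)
  qed
  with add scale bound show ?thesis
    by (intro that[of \<phi>]) (auto simp: clinear_def scaleC_complex_def)
qed

section \<open>The extension operator\<close>

lemma op_exp_diagonal:
  fixes w :: "complex \<times> 'y::complex_banach"
  shows "op_exp (\<lambda>v. (a * fst v, b *\<^sub>C snd v)) w = (exp a * fst w, exp b *\<^sub>C snd w)"
proof -
  interpret bounded_bilinear "scaleC :: complex \<Rightarrow> 'y \<Rightarrow> 'y" by (rule bounded_bilinear_scaleC)
  have pow: "((\<lambda>v. (a * fst v, b *\<^sub>C snd v)) ^^ n) w = (a ^ n * fst w, b ^ n *\<^sub>C snd w)" for n
    by (induction n) (simp_all add: scaleC_one scaleC_scaleC mult.assoc)
  have "(\<lambda>n. (a ^ n /\<^sub>R fact n * fst w, 0) + (0, (b ^ n /\<^sub>R fact n) *\<^sub>C snd w))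
      sums ((exp a * fst w, 0) + (0, exp b *\<^sub>C snd w))"
    by (intro sums_add bounded_linear.sums[OF _ exp_converges] bounded_linear_Pair bounded_linear_zero
        bounded_linear_mult_left bounded_linear_left)
  moreover have "(a ^ n /\<^sub>R fact n * fst w, 0) + (0, (b ^ n /\<^sub>R fact n) *\<^sub>C snd w)
      = (a ^ n * fst w, b ^ n *\<^sub>C snd w) /\<^sub>R fact n" for n
    by (simp add: scaleR_prod_def scaleR_left)
  ultimately show ?thesis by (simp add: op_exp_def pow sums_iff)
qed

lemma op_exp_block_op:
  fixes z :: complex and w :: "'y::complex_banach"
  shows "op_exp (\<lambda>v. (- t) *\<^sub>R block_op r \<mu> \<nu> v) (z, w) =
    (exp (- \<mu> * of_real t) * z, exp (- (\<nu> + \<mu> / of_nat r) * of_real t) *\<^sub>C w)"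
proof -
  have "(\<lambda>v :: complex \<times> 'y. (- t) *\<^sub>R block_op r \<mu> \<nu> v) =
      (\<lambda>v. ((- \<mu> * of_real t) * fst v, (- (\<nu> + \<mu> / of_nat r) * of_real t) *\<^sub>C snd v))"
  proof
    show "(- t) *\<^sub>R block_op r \<mu> \<nu> v =
        ((- \<mu> * of_real t) * fst v, (- (\<nu> + \<mu> / of_nat r) * of_real t) *\<^sub>C snd v)" for v :: "complex \<times> 'y"
      by (simp only: block_op_def case_prod_unfold scaleR_prod_def fst_conv snd_conv scaleR_scaleC
        scaleC_scaleC scaleC_complex_def of_real_minus mult_minus_left mult_minus_right mult_ac)
  qed
  then show ?thesis using op_exp_diagonal[of "- \<mu> * of_real t" "- (\<nu> + \<mu> / of_nat r) * of_real t" "(z, w)"]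
    by simp
qed

lemma bounded_clinear_diagonal:
  "bounded_clinear (\<lambda>v :: complex \<times> 'y::complex_banach. (a * fst v, b *\<^sub>C snd v))"
proof -
  interpret bounded_bilinear "scaleC :: complex \<Rightarrow> 'y \<Rightarrow> 'y" by (rule bounded_bilinear_scaleC)
  have "bounded_linear (\<lambda>v :: complex \<times> 'y. (a * fst v, b *\<^sub>C snd v))"
    by (intro bounded_linear_Pair bounded_linear_compose[OF bounded_linear_mult_right]
        bounded_linear_compose[OF bounded_linear_right] bounded_linear_fst bounded_linear_snd)
  then show ?thesis
    by (simp add: bounded_clinear_def clinear_def scaleC_prod_def scaleC_complex_def
        scaleC_add_right scaleC_scaleC algebra_simps)
qed

lemma block_op_eq: "block_op r \<mu> \<nu> = (\<lambda>v. (\<mu> * fst v, (\<nu> + \<mu> / of_nat r) *\<^sub>C snd v))"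
  by (simp add: block_op_def case_prod_unfold)

text \<open>Away from the two diagonal entries the resolvent is again diagonal. The inclusion yields
  the positive lower bound for real parts in the spectrum.\<close>

lemma op_spectrum_block_op:
  "op_spectrum (block_op r \<mu> \<nu> :: complex \<times> 'y::complex_banach \<Rightarrow> _) \<subseteq> {\<mu>, \<nu> + \<mu> / of_nat r}"
proof
  fix \<sigma> assume \<sigma>: "\<sigma> \<in> op_spectrum (block_op r \<mu> \<nu> :: complex \<times> 'y \<Rightarrow> _)"
  show "\<sigma> \<in> {\<mu>, \<nu> + \<mu> / of_nat r}"
  proof (rule ccontr)
    define b where "b = \<nu> + \<mu> / of_nat r"
    assume "\<sigma> \<notin> {\<mu>, \<nu> + \<mu> / of_nat r}"
    then have ne: "\<mu> - \<sigma> \<noteq> 0" "b - \<sigma> \<noteq> 0" by (auto simp: b_def)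
    define B where "B v = (inverse (\<mu> - \<sigma>) * fst v, inverse (b - \<sigma>) *\<^sub>C snd v)" for v :: "complex \<times> 'y"
    have diff: "block_op r \<mu> \<nu> v - \<sigma> *\<^sub>C v = ((\<mu> - \<sigma>) * fst v, (b - \<sigma>) *\<^sub>C snd v)" for v :: "complex \<times> 'y"
      by (simp add: block_op_eq scaleC_prod_def scaleC_complex_def b_def scaleC_diff_left algebra_simps)
    have "bounded_clinear B" unfolding B_def by (rule bounded_clinear_diagonal)
    moreover have "B (block_op r \<mu> \<nu> v - \<sigma> *\<^sub>C v) = v" "block_op r \<mu> \<nu> (B v) - \<sigma> *\<^sub>C B v = v" for v
      unfolding diff using ne by (simp_all add: B_def scaleC_scaleC scaleC_one flip: mult.assoc)
    ultimately show False using \<sigma> by (auto simp: op_spectrum_def)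
  qed
qed

section \<open>The ball, the image of the extension and its inverse\<close>

lemma unit_ball_r_fst:
  assumes "(x, y) \<in> unit_ball_r r"
  shows "cmod x < 1"
proof -
  have "(cmod x)\<^sup>2 + norm y ^ r < 1" "0 \<le> norm y ^ r" using assms by (auto simp: unit_ball_r_def)
  then have "(cmod x)\<^sup>2 < 1" by linarith
  then show ?thesis by (simp add: abs_square_less_1)
qed

lemma domain_in_unit_ball_r:
  assumes "r \<ge> 1"
  shows "domain_in (unit_ball_r r :: (complex \<times> 'y::complex_banach) set)"
proof -
  let ?B = "unit_ball_r r :: (complex \<times> 'y) set"
  have B: "?B = {v. (cmod (fst v))\<^sup>2 + norm (snd v) ^ r < 1}" by (auto simp: unit_ball_r_def)
  have "open ?B" unfolding B by (intro open_Collect_less continuous_intros)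
  moreover have "0 \<in> ?B" using assms by (simp add: B power_0_left)
  moreover have "closed_segment 0 v \<subseteq> ?B" if "v \<in> ?B" for v
  proof
    fix u assume "u \<in> closed_segment 0 v"
    then obtain t where t: "0 \<le> t" "t \<le> 1" "u = t *\<^sub>R v" by (auto simp: closed_segment_def)
    have "(cmod (fst u))\<^sup>2 \<le> (cmod (fst v))\<^sup>2" "norm (snd u) ^ r \<le> norm (snd v) ^ r"
      using t by (auto intro!: power_mono simp: mult_left_le_one_le)
    moreover have "(cmod (fst v))\<^sup>2 + norm (snd v) ^ r < 1" using that by (simp add: B)
    ultimately have "(cmod (fst u))\<^sup>2 + norm (snd u) ^ r < 1" by linarith
    then show "u \<in> ?B" by (simp add: B)
  qed
  ultimately have "starlike ?B" unfolding starlike_def by blast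
  then show ?thesis using \<open>open ?B\<close> \<open>0 \<in> ?B\<close> starlike_imp_connected by (auto simp: domain_in_def)
qed

lemma norm_root_branch_power:
  "root_branch r g p \<Longrightarrow> cmod x < 1 \<Longrightarrow> cmod (p x) ^ r = cmod (g x)"
  by (metis mem_ball_0 norm_power root_branch_def)

text \<open>As \<open>p u\<close> is nonzero, \<open>y\<close> is recovered from
  \<open>w = p u y\<close>, and multiplying the inequality of the ball by
  \<open>\<bar>h' u\<bar>\<close> turns it into one for \<open>w\<close>. The description no longer
  mentions \<open>p\<close>, so every branch of the root has the same image.\<close>

lemma H_hat_image_iff:
  fixes Q :: "'y::complex_banach \<Rightarrow> complex"
  assumes "r \<ge> 1" and holh: "h holomorphic_on ball 0 1" and inj: "inj_on h (ball 0 1)"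
    and p: "root_branch r (deriv h) p" and Q: "homogeneous_polynomial r Q"
  shows "(z, w) \<in> H_hat h p Q ` unit_ball_r r \<longleftrightarrow>
    (\<exists>u. cmod u < 1 \<and> h u = z - Q w \<and> norm w ^ r < conformal_radius h u)"
proof -
  have h': "deriv h u \<noteq> 0" if "cmod u < 1" for u
    using holomorphic_injective_imp_regular[OF holh _ inj] that by simp
  have pu: "p u ^ r = deriv h u" if "cmod u < 1" for u
    using p that by (simp add: root_branch_def)
  have pnz: "p u \<noteq> 0" if "cmod u < 1" for u
    using pu[OF that] h'[OF that] \<open>r \<ge> 1\<close> by (auto simp: power_0_left)
  have Qp: "Q (p u *\<^sub>C y) = deriv h u * Q y" if "cmod u < 1" for u y
    using homogeneous_polynomial_scaleC[OF Q] pu[OF that] by simp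
  have rad: "norm (p u *\<^sub>C y) ^ r < conformal_radius h u \<longleftrightarrow> (u, y) \<in> unit_ball_r r" if "cmod u < 1" for u and y :: 'y
  proof -
    have "norm (p u *\<^sub>C y) ^ r = norm y ^ r * cmod (deriv h u)"
      using norm_root_branch_power[OF p that] by (simp add: norm_scaleC power_mult_distrib)
    then show ?thesis using h'[OF that]
      by (auto simp: conformal_radius_def unit_ball_r_def mult_less_cancel_right)
  qed
  show ?thesis
  proof
    assume "(z, w) \<in> H_hat h p Q ` unit_ball_r r"
    then obtain u y where uy: "(u, y) \<in> unit_ball_r r" "z = h u + deriv h u * Q y" "w = p u *\<^sub>C y"
      by (auto simp: H_hat_def)
    have "cmod u < 1" using unit_ball_r_fst[OF uy(1)] .
    then show "\<exists>u. cmod u < 1 \<and> h u = z - Q w \<and> norm w ^ r < conformal_radius h u"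
      using uy Qp rad by (intro exI[of _ u]) auto
  next
    assume "\<exists>u. cmod u < 1 \<and> h u = z - Q w \<and> norm w ^ r < conformal_radius h u"
    then obtain u where u: "cmod u < 1" "h u = z - Q w" "norm w ^ r < conformal_radius h u" by blast
    define y where "y = inverse (p u) *\<^sub>C w"
    have w: "w = p u *\<^sub>C y" using pnz[OF u(1)] by (simp add: y_def scaleC_scaleC scaleC_one)
    then have "(u, y) \<in> unit_ball_r r" using rad[OF u(1), of y] u(3) by simp
    moreover have "(z, w) = H_hat h p Q (u, y)"
      using u(2) Qp[OF u(1), of y] w by (simp add: H_hat_def)
    ultimately show "(z, w) \<in> H_hat h p Q ` unit_ball_r r" by blast
  qed
qed

text \<open>The inverse \<open>K\<close> subtracts \<open>Q w\<close> from the first coordinate,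
  applies the inverse \<open>g\<close> of \<open>h\<close>, and divides \<open>w\<close> by
  \<open>p\<close>. Openness of the image follows from its description: there
  \<open>conformal_radius h (g (s v)) - norm (snd v) ^ r\<close> is positive, on an open set where
  it is continuous.\<close>

lemma H_hat_biholomorphic:
  fixes Q :: "'y::complex_banach \<Rightarrow> complex"
  assumes "r \<ge> 1" and holh: "h holomorphic_on ball 0 1" and inj: "inj_on h (ball 0 1)"
    and p: "root_branch r (deriv h) p" and Q: "homogeneous_polynomial r Q"
  shows "biholomorphic_on_image (unit_ball_r r) (H_hat h p Q)"
proof -
  let ?B = "unit_ball_r r :: (complex \<times> 'y) set"
  note img = H_hat_image_iff[OF assms]
  have h': "deriv h u \<noteq> 0" if "cmod u < 1" for u
    using holomorphic_injective_imp_regular[OF holh _ inj] that by simp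
  have holp: "p holomorphic_on ball 0 1" using p by (simp add: root_branch_def)
  have pu: "p u ^ r = deriv h u" if "cmod u < 1" for u
    using p that by (simp add: root_branch_def)
  have pnz: "p u \<noteq> 0" if "cmod u < 1" for u
    using pu[OF that] h'[OF that] \<open>r \<ge> 1\<close> by (auto simp: power_0_left)
  have Qp: "Q (p u *\<^sub>C y) = deriv h u * Q y" if "cmod u < 1" for u y
    using homogeneous_polynomial_scaleC[OF Q] pu[OF that] by simp
  have fQ: "frechet_at Q y" for y by (rule homogeneous_polynomial_frechet_at[OF Q])
  obtain g where holg: "g holomorphic_on h ` ball 0 1" and gh: "\<And>u. u \<in> ball 0 1 \<Longrightarrow> g (h u) = u"
    using holomorphic_has_inverse[OF holh open_ball inj] by metis
  have op: "open (h ` ball 0 1)" using open_mapping_thm3[OF holh open_ball inj] .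
  define s where "s v = fst v - Q (snd v)" for v
  define K where "K v = (g (s v), inverse (p (g (s v))) *\<^sub>C snd v)" for v
  have fs: "frechet_at s v" for v
    unfolding s_def[abs_def] diff_conv_add_uminus
    by (intro frechet_at_add frechet_at_minus frechet_at_fst frechet_at_compose[OF frechet_at_snd fQ] frechet_at_id)
  have u1: "cmod (fst v) < 1" if "v \<in> ?B" for v
    using unit_ball_r_fst[of "fst v" "snd v"] that by simp
  have sG: "s (H_hat h p Q v) = h (fst v)" if "v \<in> ?B" for v
    using Qp[OF u1[OF that]] by (simp add: s_def H_hat_def case_prod_unfold)
  have "H_hat h p Q ` ?B = {v \<in> s -` (h ` ball 0 1). 0 < conformal_radius h (g (s v)) - norm (snd v) ^ r}"
  proof (rule set_eqI)
    fix v
    have "v \<in> H_hat h p Q ` ?B \<longleftrightarrow>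
        (\<exists>u. cmod u < 1 \<and> h u = s v \<and> norm (snd v) ^ r < conformal_radius h u)"
      using img[of "fst v" "snd v"] by (simp add: s_def)
    also have "\<dots> \<longleftrightarrow> s v \<in> h ` ball 0 1 \<and> norm (snd v) ^ r < conformal_radius h (g (s v))"
    proof
      assume "\<exists>u. cmod u < 1 \<and> h u = s v \<and> norm (snd v) ^ r < conformal_radius h u"
      then obtain u where u: "u \<in> ball 0 1" "h u = s v" "norm (snd v) ^ r < conformal_radius h u" by auto
      then show "s v \<in> h ` ball 0 1 \<and> norm (snd v) ^ r < conformal_radius h (g (s v))"
        using gh[OF u(1)] by (metis image_eqI)
    next
      assume *: "s v \<in> h ` ball 0 1 \<and> norm (snd v) ^ r < conformal_radius h (g (s v))"
      then obtain u where "u \<in> ball 0 1" "s v = h u" by blast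
      with * gh[of u] show "\<exists>u. cmod u < 1 \<and> h u = s v \<and> norm (snd v) ^ r < conformal_radius h u"
        by (intro exI[of _ u]) simp
    qed
    finally show "v \<in> H_hat h p Q ` ?B \<longleftrightarrow>
        v \<in> {v \<in> s -` (h ` ball 0 1). 0 < conformal_radius h (g (s v)) - norm (snd v) ^ r}"
      by simp
  qed
  moreover have "open {v \<in> s -` (h ` ball 0 1). 0 < conformal_radius h (g (s v)) - norm (snd v) ^ r}"
  proof -
    have conts: "continuous_on A s" for A
      using frechet_at_imp_isCont[OF fs] by (simp add: continuous_at_imp_continuous_on)
    have contR: "continuous_on (ball 0 1) (conformal_radius h)"
      unfolding conformal_radius_def
      by (intro continuous_intros holomorphic_on_imp_continuous_on holomorphic_deriv[OF holh]) auto
    have "continuous_on (s -` (h ` ball 0 1)) (\<lambda>v. g (s v))"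
      by (rule continuous_on_compose2[OF holomorphic_on_imp_continuous_on[OF holg] conts]) auto
    then have "continuous_on (s -` (h ` ball 0 1)) (\<lambda>v. conformal_radius h (g (s v)))"
      by (rule continuous_on_compose2[OF contR]) (use gh in auto)
    then have "continuous_on (s -` (h ` ball 0 1)) (\<lambda>v. conformal_radius h (g (s v)) - norm (snd v) ^ r)"
      by (intro continuous_intros)
    moreover have "open (s -` (h ` ball 0 1))"
      using conts[of UNIV] op by (rule open_vimage[rotated])
    ultimately have "open (s -` (h ` ball 0 1) \<inter> (\<lambda>v. conformal_radius h (g (s v)) - norm (snd v) ^ r) -` {0<..})"
      by (rule continuous_open_preimage) auto
    then show ?thesis by (simp add: Int_def vimage_def)
  qed
  ultimately have opG: "open (H_hat h p Q ` ?B)" by simp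
  show ?thesis
  proof (rule biholomorphic_on_imageI[where K = K])
    show "domain_in ?B" by (rule domain_in_unit_ball_r[OF \<open>r \<ge> 1\<close>])
    show "open (H_hat h p Q ` ?B)" by (rule opG)
    fix v assume v: "v \<in> ?B"
    then have ball: "fst v \<in> ball 0 1" using u1 by simp
    show "K (H_hat h p Q v) = v"
      using gh[OF ball] pnz[OF u1[OF v]]
      by (simp add: K_def sG[OF v]) (simp add: H_hat_def case_prod_unfold scaleC_scaleC scaleC_one)
    have H: "H_hat h p Q = (\<lambda>v. (h (fst v) + deriv h (fst v) *\<^sub>C Q (snd v), p (fst v) *\<^sub>C snd v))"
      by (simp add: H_hat_def case_prod_unfold scaleC_complex_def)
    have fst: "frechet_at fst v" and snd: "frechet_at snd v"
      by (rule frechet_at_fst[OF frechet_at_id], rule frechet_at_snd[OF frechet_at_id])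
    show "frechet_at (H_hat h p Q) v"
      unfolding H using ball holh holp holomorphic_deriv[OF holh open_ball]
      by (intro frechet_at_Pair frechet_at_add frechet_at_scaleC fst snd
          frechet_at_compose[OF snd fQ] frechet_at_compose[OF fst frechet_at_holomorphic[OF _ open_ball]])
  next
    fix w assume "w \<in> H_hat h p Q ` ?B"
    then obtain v where v: "v \<in> ?B" "w = H_hat h p Q v" by blast
    then have ball: "fst v \<in> ball 0 1" using u1 by simp
    then have sw: "s w \<in> h ` ball 0 1" "g (s w) \<in> ball 0 1" using sG v gh by auto
    have fg: "frechet_at (\<lambda>v. g (s v)) w"
      by (rule frechet_at_compose[OF fs frechet_at_holomorphic[OF holg op sw(1)]])
    have "frechet_at (\<lambda>u. inverse (p u)) (g (s w))"
      by (rule frechet_at_holomorphic[OF _ open_ball sw(2)]) (use pnz holp in \<open>auto intro!: holomorphic_intros\<close>)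
    then show "frechet_at K w"
      unfolding K_def[abs_def]
      by (intro frechet_at_Pair frechet_at_scaleC fg frechet_at_snd[OF frechet_at_id] frechet_at_compose[OF fg])
  qed
qed

section \<open>Invariance of the image under the linear flow\<close>

lemma exp_power_block:
  fixes \<mu> \<nu> :: complex
  assumes "r \<ge> 1"
  shows "exp (- (\<nu> + \<mu> / of_nat r) * of_real t) ^ r = exp (- \<mu> * of_real t) * exp (- \<nu> * of_real (real r * t))"
proof -
  have "R * (- (\<nu> + m) * T) = - \<mu> * T + - \<nu> * (R * T)" if "R * m = \<mu>" for R m T
    unfolding that[symmetric] by (simp add: algebra_simps)
  from this[of "of_nat r" "\<mu> / of_nat r" "of_real t"]
  have "of_nat r * (- (\<nu> + \<mu> / of_nat r) * of_real t) = - \<mu> * of_real t + - \<nu> * of_real (real r * t)"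
    using assms by simp
  then show ?thesis unfolding exp_of_nat_mult[symmetric] exp_add[symmetric] by simp
qed

lemma H_hat_spirallike:
  fixes Q :: "'y::complex_banach \<Rightarrow> complex"
  assumes "r \<ge> 1" and "0 < Re \<mu>" and sp: "disc_spirallike \<mu> h" and p: "root_branch r (deriv h) p"
    and Q: "homogeneous_polynomial r Q" and \<nu>: "0 < Re \<nu>"
    and bound: "(SUP y\<in>sphere 0 1. cmod (Q y)) \<le> 1 / 4 * (Re \<nu> / cmod \<nu>)"
  shows "op_spirallike (block_op r \<mu> \<nu>) (unit_ball_r r) (H_hat h p Q)"
proof -
  have holh: "h holomorphic_on ball 0 1" and inj: "inj_on h (ball 0 1)"
    using sp by (auto simp: disc_spirallike_def)
  note img = H_hat_image_iff[OF \<open>r \<ge> 1\<close> holh inj p Q]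
  have "cmod \<nu> \<noteq> 0" using \<nu> by auto
  have Qle: "4 * cmod (Q y) \<le> Re \<nu> / cmod \<nu> * norm y ^ r" for y
  proof -
    have "cmod (Q y) \<le> 1 / 4 * (Re \<nu> / cmod \<nu>) * norm y ^ r"
      by (rule order.trans[OF homogeneous_polynomial_le_SUP[OF Q \<open>r \<ge> 1\<close>] mult_right_mono[OF bound]]) simp
    then show ?thesis by simp
  qed
  have inv: "op_exp (\<lambda>v. (- t) *\<^sub>R block_op r \<mu> \<nu> v) (z, w) \<in> H_hat h p Q ` unit_ball_r r"
    if zw: "(z, w) \<in> H_hat h p Q ` unit_ball_r r" and t: "0 \<le> t" for z w t
  proof -
    define e where "e = exp (- (\<nu> + \<mu> / of_nat r) * of_real t)"
    define E where "E = exp (- Re \<nu> * (real r * t))"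
    \<comment> \<open>Chosen so that \<open>exp (- \<mu> t) * (h u + d)\<close> equals
      \<open>exp (- \<mu> t) * z - Q (e w)\<close>, the value of \<open>h\<close> that the criterion
      for the image demands of the transformed pair.\<close>
    define d where "d = (1 - exp (- \<nu> * of_real (real r * t))) * Q w"
    obtain u where u: "cmod u < 1" "h u = z - Q w" "norm w ^ r < conformal_radius h u"
      using zw img by blast
    have er: "e ^ r = exp (- \<mu> * of_real t) * exp (- \<nu> * of_real (real r * t))"
      unfolding e_def by (rule exp_power_block[OF \<open>r \<ge> 1\<close>])
    have "E \<le> 1" using \<nu> t by (simp add: E_def)
    have "4 * cmod d = cmod (1 - exp (- \<nu> * of_real (real r * t))) * (4 * cmod (Q w))"
      by (simp add: d_def norm_mult)
    \<comment> \<open>The quotients \<open>cmod \<nu> / Re \<nu>\<close> and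
      \<open>Re \<nu> / cmod \<nu>\<close> cancel; the bound on \<open>Q\<close> has just the size
      that makes this happen.\<close>
    also have "\<dots> \<le> (cmod \<nu> / Re \<nu> * (1 - E)) * (Re \<nu> / cmod \<nu> * norm w ^ r)"
    proof (rule mult_mono[OF _ Qle])
      show "cmod (1 - exp (- \<nu> * of_real (real r * t))) \<le> cmod \<nu> / Re \<nu> * (1 - E)"
        unfolding E_def using t by (intro norm_one_minus_exp_le[OF \<nu>]) simp
    qed (use \<nu> \<open>E \<le> 1\<close> in auto)
    also have "\<dots> = (1 - E) * norm w ^ r" using \<nu> \<open>cmod \<nu> \<noteq> 0\<close> by (simp add: field_simps)
    finally have d: "4 * cmod d \<le> norm w ^ r - E * norm w ^ r" by (simp add: algebra_simps)
    moreover have "0 \<le> E * norm w ^ r" by (simp add: E_def)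
    ultimately have "4 * cmod d < conformal_radius h u" using u(3) by linarith
    then obtain y where y: "cmod y < 1" "h y = exp (- \<mu> * of_real t) * (h u + d)"
      "exp (- Re \<mu> * t) * (conformal_radius h u - 4 * cmod d) \<le> conformal_radius h y"
      using spirallike_flow[OF sp u(1) t, of d] by blast
    have "norm (e *\<^sub>C w) ^ r = cmod (e ^ r) * norm w ^ r"
      by (simp add: norm_scaleC power_mult_distrib norm_power)
    also have "cmod (e ^ r) = exp (- Re \<mu> * t) * E"
      unfolding er by (simp add: norm_mult E_def)
    also have "exp (- Re \<mu> * t) * E * norm w ^ r < exp (- Re \<mu> * t) * (conformal_radius h u - 4 * cmod d)"
      using d u(3) by (simp add: mult.assoc)
    also have "\<dots> \<le> conformal_radius h y" by (rule y(3))
    finally have "norm (e *\<^sub>C w) ^ r < conformal_radius h y" .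
    moreover have "Q (e *\<^sub>C w) = e ^ r * Q w" by (rule homogeneous_polynomial_scaleC[OF Q])
    then have "h y = exp (- \<mu> * of_real t) * z - Q (e *\<^sub>C w)"
      unfolding y(2) er u(2) d_def by (simp add: algebra_simps)
    ultimately show ?thesis
      unfolding op_exp_block_op img e_def[symmetric] using y(1) by blast
  qed
  have spec: "\<exists>\<delta>>0. \<forall>\<sigma>\<in>op_spectrum (block_op r \<mu> \<nu> :: complex \<times> 'y \<Rightarrow> _). \<delta> \<le> Re \<sigma>"
  proof (intro exI conjI ballI)
    have "0 < Re (\<nu> + \<mu> / of_nat r)" using \<nu> \<open>0 < Re \<mu>\<close> \<open>r \<ge> 1\<close> by (simp add: Re_divide_of_nat add_pos_pos)
    then show "0 < min (Re \<mu>) (Re (\<nu> + \<mu> / of_nat r))" using \<open>0 < Re \<mu>\<close> by simp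
    fix \<sigma> assume "\<sigma> \<in> op_spectrum (block_op r \<mu> \<nu> :: complex \<times> 'y \<Rightarrow> _)"
    then have "\<sigma> \<in> {\<mu>, \<nu> + \<mu> / of_nat r}" using op_spectrum_block_op by blast
    then show "min (Re \<mu>) (Re (\<nu> + \<mu> / of_nat r)) \<le> Re \<sigma>" by auto
  qed
  have "bounded_clinear (block_op r \<mu> \<nu> :: complex \<times> 'y \<Rightarrow> _)"
    unfolding block_op_eq by (rule bounded_clinear_diagonal)
  moreover have "\<forall>v\<in>H_hat h p Q ` unit_ball_r r. \<forall>t\<ge>0.
      op_exp (\<lambda>v. (- t) *\<^sub>R block_op r \<mu> \<nu> v) v \<in> H_hat h p Q ` unit_ball_r r"
    using inv by (metis surj_pair)
  ultimately show ?thesis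
    unfolding op_spirallike_def using H_hat_biholomorphic[OF \<open>r \<ge> 1\<close> holh inj p Q] spec by blast
qed

section \<open>Sharpness: the slit plane and a power of a norming functional\<close>

lemma homogeneous_polynomial_power_functional:
  fixes \<phi> :: "'a::complex_normed_vector \<Rightarrow> complex"
  assumes lin: "clinear \<phi>" and le: "\<And>x. cmod (\<phi> x) \<le> norm x"
  shows "homogeneous_polynomial r (\<lambda>y. c * \<phi> y ^ r)"
proof -
  define L where "L u = c * (\<Prod>i<r. \<phi> (u i))" for u :: "nat \<Rightarrow> 'a"
  have "bounded_multilinear r L"
    unfolding bounded_multilinear_def
  proof (intro conjI allI impI)
    show "L u = L v" if "\<forall>i<r. u i = v i" for u v using that by (simp add: L_def)
    fix i and v :: "nat \<Rightarrow> 'a" assume "i < r"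
    have "L (v(i := u)) = c * (\<phi> u * (\<Prod>j\<in>{..<r} - {i}. \<phi> (v j)))" for u
    proof -
      have "(\<Prod>j\<in>{..<r} - {i}. \<phi> ((v(i := u)) j)) = (\<Prod>j\<in>{..<r} - {i}. \<phi> (v j))"
        by (rule prod.cong) auto
      then show ?thesis using \<open>i < r\<close> by (simp add: L_def prod.remove[of "{..<r}" i])
    qed
    then show "clinear (\<lambda>u. L (v(i := u)))"
      using lin by (simp add: clinear_def scaleC_complex_def algebra_simps)
  next
    show "\<exists>M. \<forall>v. norm (L v) \<le> M * (\<Prod>i<r. norm (v i))"
    proof (intro exI allI)
      fix v :: "nat \<Rightarrow> 'a"
      have "(\<Prod>i<r. cmod (\<phi> (v i))) \<le> (\<Prod>i<r. norm (v i))"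
        by (intro prod_mono) (simp add: le)
      then show "norm (L v) \<le> cmod c * (\<Prod>i<r. norm (v i))"
        by (simp add: L_def norm_mult prod_norm mult_left_mono flip: prod_norm)
    qed
  qed
  moreover have "c * \<phi> y ^ r = L (\<lambda>_. y)" for y by (simp add: L_def)
  ultimately show ?thesis unfolding homogeneous_polynomial_def by blast
qed

text \<open>The square of the Cayley map onto the right half-plane; equivalently
  \<open>1 + 4 k\<close> with the Koebe function \<open>k z = z / (1 - z) ^ 2\<close>. In this
  normalisation the slit ends at 0, so the image is invariant under positive scaling.\<close>

definition slit_map :: "complex \<Rightarrow> complex" where
  "slit_map z = ((1 + z) / (1 - z))\<^sup>2"

lemma Re_cayley_pos:
  assumes "cmod z < 1"
  shows "0 < Re ((1 + z) / (1 - z))"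
proof -
  have "z \<noteq> 1" using assms by auto
  have "(1 + z) / (1 - z) = (1 + z) * cnj (1 - z) / (cmod (1 - z))\<^sup>2"
    using \<open>z \<noteq> 1\<close> by (subst complex_norm_square) simp
  moreover have "Re ((1 + z) * cnj (1 - z)) = 1 - (cmod z)\<^sup>2"
    unfolding cmod_power2 by (simp add: power2_eq_square algebra_simps)
  ultimately have "Re ((1 + z) / (1 - z)) = (1 - (cmod z)\<^sup>2) / (cmod (1 - z))\<^sup>2"
    by (metis Re_divide_of_real of_real_power)
  then show ?thesis
    using one_minus_norm_square_pos[OF assms] \<open>z \<noteq> 1\<close> by simp
qed

lemma cayley_surj:
  assumes "0 < Re u"
  obtains z where "cmod z < 1" "(1 + z) / (1 - z) = u"
proof
  have "u + 1 \<noteq> 0" using assms by (auto simp: complex_eq_iff)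
  then have "1 + (u - 1) / (u + 1) = u * (2 / (u + 1))" "1 - (u - 1) / (u + 1) = 2 / (u + 1)"
    by (simp_all add: field_simps)
  then show "(1 + (u - 1) / (u + 1)) / (1 - (u - 1) / (u + 1)) = u" using \<open>u + 1 \<noteq> 0\<close> by simp
  have "(cmod (u - 1))\<^sup>2 < (cmod (u + 1))\<^sup>2"
    using assms unfolding cmod_power2 by (simp add: power2_eq_square algebra_simps)
  then have "cmod (u - 1) < cmod (u + 1)" by (rule power2_less_imp_less) simp
  then show "cmod ((u - 1) / (u + 1)) < 1" using \<open>u + 1 \<noteq> 0\<close> by (simp add: norm_divide)
qed

lemma disc_spirallike_slit_map: "disc_spirallike 1 slit_map"
  unfolding disc_spirallike_def
proof (intro conjI allI impI)
  have "1 - z \<noteq> 0" if "z \<in> ball (0 :: complex) 1" for z using that by auto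
  then show "slit_map holomorphic_on ball 0 1"
    unfolding slit_map_def by (intro holomorphic_intros) auto
  show "inj_on slit_map (ball 0 1)"
  proof (rule inj_onI)
    fix z w :: complex assume z: "z \<in> ball 0 1" and w: "w \<in> ball 0 1" and "slit_map z = slit_map w"
    then consider "(1 + z) / (1 - z) = (1 + w) / (1 - w)" | "(1 + z) / (1 - z) = - ((1 + w) / (1 - w))"
      using power2_eq_iff unfolding slit_map_def by blast
    then show "z = w"
    proof cases
      case 1
      have "z \<noteq> 1" "w \<noteq> 1" using z w by auto
      then show ?thesis using 1 by (simp add: field_simps)
    next
      case 2
      then have "Re ((1 + z) / (1 - z)) = - Re ((1 + w) / (1 - w))" by (simp only: uminus_complex.sel)
      then show ?thesis using Re_cayley_pos[of z] Re_cayley_pos[of w] z w by simp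
    qed
  qed
  fix t :: real assume "0 \<le> t"
  show "(\<lambda>w. exp (- 1 * complex_of_real t) * w) ` slit_map ` ball 0 1 \<subseteq> slit_map ` ball 0 1"
  proof clarify
    fix z :: complex assume "z \<in> ball 0 1"
    \<comment> \<open>The exponent is halved because \<open>slit_map\<close> squares the Cayley
      value.\<close>
    define u where "u = of_real (exp (- t / 2)) * ((1 + z) / (1 - z))"
    have "Re (of_real a * v) = a * Re v" for a v by simp
    then have "Re u = exp (- t / 2) * Re ((1 + z) / (1 - z))" unfolding u_def .
    then have "0 < Re u" using Re_cayley_pos[of z] \<open>z \<in> ball 0 1\<close> by simp
    then obtain y where y: "cmod y < 1" "(1 + y) / (1 - y) = u" by (rule cayley_surj)
    have "(complex_of_real (exp (- t / 2)))\<^sup>2 = exp (- 1 * complex_of_real t)"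
      by (simp flip: exp_double exp_of_real)
    then have "exp (- 1 * complex_of_real t) * slit_map z = slit_map y"
      by (simp add: slit_map_def y(2) u_def power_mult_distrib power_divide)
    then show "exp (- 1 * complex_of_real t) * slit_map z \<in> slit_map ` ball 0 1"
      using y(1) by auto
  qed
qed simp

lemma slit_map_nonzero: "cmod z < 1 \<Longrightarrow> slit_map z \<noteq> 0"
  using Re_cayley_pos[of z] by (auto simp: slit_map_def)

text \<open>Since \<open>slit_map 0 = 1\<close>, this is equality in the quarter theorem for the
  omitted value 0.\<close>

lemma conformal_radius_slit_map_0: "conformal_radius slit_map 0 = 4"
proof -
  have "(slit_map has_field_derivative 4) (at 0)"
    unfolding slit_map_def[abs_def] by (auto intro!: derivative_eq_intros)
  then show ?thesis by (simp add: conformal_radius_def DERIV_imp_deriv)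
qed

lemma root_branch_exists:
  assumes "r \<ge> 1" and holh: "h holomorphic_on ball 0 1" and inj: "inj_on h (ball 0 1)"
  obtains p where "root_branch r (deriv h) p"
proof -
  have "deriv h z \<noteq> 0" if "z \<in> ball 0 1" for z
    using holomorphic_injective_imp_regular[OF holh open_ball inj that] .
  then obtain g where g: "g holomorphic_on ball 0 1" "\<And>z. z \<in> ball 0 1 \<Longrightarrow> deriv h z = exp (g z)"
    using contractible_imp_holomorphic_log[OF holomorphic_deriv[OF holh open_ball]
        convex_imp_contractible[OF convex_ball]] by blast
  have "root_branch r (deriv h) (\<lambda>z. exp (g z / of_nat r))"
    unfolding root_branch_def using assms(1) g
    by (auto intro!: holomorphic_intros simp flip: exp_of_nat_mult)
  then show ?thesis using that by blast
qed

text \<open>At \<open>s = 0\<close> both sides are 1. The argument of \<open>c\<close> makes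
  \<open>c * \<nu>\<close> a negative real, so the left side starts with slope
  \<open>- 4 * C * cmod \<nu>\<close>, which is below the slope \<open>- Re \<nu>\<close> of the
  right side.\<close>

lemma norm_exp_comparison_fails:
  assumes "0 < Re \<nu>" "Re \<nu> / cmod \<nu> < 4 * C"
  defines "c \<equiv> - of_real C * cnj (sgn \<nu>)"
  obtains s where "0 < s" "cmod (1 + 4 * c * (1 - exp (- \<nu> * of_real s))) < exp (- Re \<nu> * s)"
proof -
  have "\<nu> \<noteq> 0" using assms by auto
  have "sgn \<nu> * cmod \<nu> = \<nu>" using \<open>\<nu> \<noteq> 0\<close> by (simp add: sgn_eq)
  then have "c * \<nu> = - of_real C * (sgn \<nu> * cnj (sgn \<nu>)) * cmod \<nu>"
    unfolding c_def by (metis (no_types, lifting) mult.assoc mult.commute mult.left_commute)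
  also have "sgn \<nu> * cnj (sgn \<nu>) = 1"
    using \<open>\<nu> \<noteq> 0\<close> complex_norm_square[of "sgn \<nu>"] by (simp add: norm_sgn)
  finally have c\<nu>: "c * \<nu> = - of_real (C * cmod \<nu>)" by simp
  define Z where "Z s = 1 + 4 * c * (1 - exp (- \<nu> * of_real s))" for s
  \<comment> \<open>A difference of squares, which avoids differentiating the modulus.\<close>
  define f where "f s = (Re (Z s))\<^sup>2 + (Im (Z s))\<^sup>2 - exp (- 2 * Re \<nu> * s)" for s
  have "((\<lambda>z. 1 + 4 * c * (1 - exp (- \<nu> * z))) has_field_derivative 4 * (c * \<nu>)) (at (of_real 0))"
    by (auto intro!: derivative_eq_intros)
  from has_vector_derivative_real_field[OF this]
  have Z': "(Z has_vector_derivative - of_real (4 * (C * cmod \<nu>))) (at 0)"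
    by (simp add: Z_def[abs_def] c\<nu>)
  have ReZ: "((\<lambda>s. Re (Z s)) has_real_derivative - (4 * (C * cmod \<nu>))) (at 0)"
    using has_field_derivative_Re[OF Z'] by simp
  have ImZ: "((\<lambda>s. Im (Z s)) has_real_derivative 0) (at 0)"
    using has_field_derivative_Im[OF Z'] by simp
  have "Z 0 = 1" by (simp add: Z_def)
  have "((\<lambda>s. (P s)\<^sup>2 + (R s)\<^sup>2 - exp (- 2 * Re \<nu> * s)) has_real_derivative 2 * a + 2 * Re \<nu>) (at 0)"
    if "(P has_real_derivative a) (at 0)" "(R has_real_derivative 0) (at 0)" "P 0 = 1" "R 0 = 0" for P R a
    using that by (auto intro!: derivative_eq_intros)
  from this[OF ReZ ImZ] have "(f has_real_derivative - 8 * (C * cmod \<nu>) + 2 * Re \<nu>) (at 0)"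
    unfolding f_def[abs_def] by (simp add: \<open>Z 0 = 1\<close>)
  moreover have "Re \<nu> < 4 * C * cmod \<nu>" using assms(2) \<open>\<nu> \<noteq> 0\<close> by (simp add: field_simps)
  then have "- 8 * (C * cmod \<nu>) + 2 * Re \<nu> < 0" by simp
  ultimately obtain d where "0 < d" "\<And>s. 0 < s \<Longrightarrow> s < d \<Longrightarrow> f (0 + s) < f 0"
    using DERIV_neg_dec_right by blast
  from this(2)[of "d / 2"] \<open>0 < d\<close> have "f (d / 2) < 0" by (simp add: f_def \<open>Z 0 = 1\<close>)
  then have "(cmod (Z (d / 2)))\<^sup>2 < (exp (- Re \<nu> * (d / 2)))\<^sup>2"
    by (simp add: f_def cmod_power2 flip: exp_double)
  then have "cmod (Z (d / 2)) < exp (- Re \<nu> * (d / 2))" by (rule power2_less_imp_less) simp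
  then show ?thesis using that[of "d / 2"] \<open>0 < d\<close> by (simp add: Z_def)
qed

lemma H_hat_bound_sharp:
  fixes \<nu> :: complex and C :: real
  assumes "r \<ge> 1" and nonzero: "\<exists>y::'y::complex_banach. y \<noteq> 0"
    and \<nu>: "0 < Re \<nu>" and C: "1 / 4 * (Re \<nu> / cmod \<nu>) < C"
  obtains h p and Q :: "'y::complex_banach \<Rightarrow> complex" where "disc_spirallike 1 h" "root_branch r (deriv h) p"
    "homogeneous_polynomial r Q" "(SUP y\<in>sphere 0 1. cmod (Q y)) \<le> C"
    "\<not> op_spirallike (block_op r 1 \<nu>) (unit_ball_r r) (H_hat h p Q)"
proof -
  have "0 < cmod \<nu>" using \<nu> by auto
  then have "0 < Re \<nu> / cmod \<nu>" using \<nu> by simp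
  then have "0 < C" using C by linarith
  obtain y0 :: 'y where "norm y0 = 1"
  proof -
    obtain y :: 'y where "y \<noteq> 0" using nonzero by blast
    then show ?thesis using that[of "y /\<^sub>R norm y"] by simp
  qed
  obtain \<phi> :: "'y \<Rightarrow> complex" where \<phi>: "clinear \<phi>" "\<And>x. cmod (\<phi> x) \<le> norm x" "\<phi> y0 = 1"
    using norming_functional[OF \<open>norm y0 = 1\<close>] by blast
  define c where "c = - of_real C * cnj (sgn \<nu>)"
  have "cmod c = C" using \<open>0 < C\<close> \<open>0 < cmod \<nu>\<close> by (simp add: c_def norm_mult norm_sgn)
  define Q where "Q y = c * \<phi> y ^ r" for y
  have Q: "homogeneous_polynomial r Q"
    unfolding Q_def by (rule homogeneous_polynomial_power_functional[OF \<phi>(1,2)])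
  have holh: "slit_map holomorphic_on ball 0 1" and inj: "inj_on slit_map (ball 0 1)"
    using disc_spirallike_slit_map by (auto simp: disc_spirallike_def)
  obtain p where p: "root_branch r (deriv slit_map) p"
    using root_branch_exists[OF \<open>r \<ge> 1\<close> holh inj] .
  note img = H_hat_image_iff[OF \<open>r \<ge> 1\<close> holh inj p Q]
  have "(SUP y\<in>sphere 0 1. cmod (Q y)) \<le> C"
  proof (rule cSUP_least)
    show "sphere 0 1 \<noteq> ({} :: 'y set)" using \<open>norm y0 = 1\<close> by auto
    fix y :: 'y assume "y \<in> sphere 0 1"
    then have "cmod (\<phi> y) ^ r \<le> 1" using \<phi>(2)[of y] by (intro power_le_one) auto
    then show "cmod (Q y) \<le> C"
      using \<open>cmod c = C\<close> \<open>0 < C\<close> by (simp add: Q_def norm_mult norm_power mult_left_le)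
  qed
  moreover have "\<not> op_spirallike (block_op r 1 \<nu>) (unit_ball_r r) (H_hat slit_map p Q)"
  proof
    assume "op_spirallike (block_op r 1 \<nu>) (unit_ball_r r) (H_hat slit_map p Q)"
    then have inv: "op_exp (\<lambda>v. (- t) *\<^sub>R block_op r 1 \<nu> v) v \<in> H_hat slit_map p Q ` unit_ball_r r"
      if "v \<in> H_hat slit_map p Q ` unit_ball_r r" "0 \<le> t" for v t
      using that unfolding op_spirallike_def by blast
    obtain s where s: "0 < s" "cmod (1 + 4 * c * (1 - exp (- \<nu> * of_real s))) < exp (- Re \<nu> * s)"
      using norm_exp_comparison_fails[OF \<nu>, of C] C unfolding c_def by auto
    \<comment> \<open>In the power \<open>e ^ r\<close> the \<open>\<nu>\<close>-part of the flow
      runs \<open>r\<close> times as fast.\<close>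
    define t where "t = s / real r"
    have t: "0 \<le> t" "real r * t = s" using s(1) \<open>r \<ge> 1\<close> by (auto simp: t_def)
    define e where "e = exp (- (\<nu> + 1 / of_nat r) * of_real t)"
    have er: "e ^ r = exp (- of_real t) * exp (- \<nu> * of_real s)"
      using exp_power_block[OF \<open>r \<ge> 1\<close>, of \<nu> 1 t] t(2) by (simp add: e_def)
    have ineq: "exp (- Re \<nu> * s) * \<sigma> \<le> 4 * cmod (1 + c * \<sigma> * (1 - exp (- \<nu> * of_real s)))"
      if \<sigma>: "0 < \<sigma>" "\<sigma> < 4" for \<sigma>
    proof -
      define w where "w = of_real (root r \<sigma>) *\<^sub>C y0"
      have root: "root r \<sigma> ^ r = \<sigma>" "0 \<le> root r \<sigma>" using \<sigma> \<open>r \<ge> 1\<close> by auto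
      have w: "norm w ^ r = \<sigma>" using root \<open>norm y0 = 1\<close> by (simp add: w_def norm_scaleC)
      have "\<phi> w = of_real (root r \<sigma>)"
        using \<phi>(1,3) by (simp add: w_def clinear_def scaleC_complex_def)
      then have Qw: "Q w = c * \<sigma>" using root by (simp add: Q_def flip: of_real_power)
      \<comment> \<open>The witness is \<open>u = 0\<close>, where \<open>slit_map\<close> is 1 and
        the conformal radius 4 exceeds \<open>\<sigma>\<close>.\<close>
      have "(1 + c * \<sigma>, w) \<in> H_hat slit_map p Q ` unit_ball_r r"
        unfolding img by (rule exI[of _ 0]) (use \<sigma> in \<open>simp add: w Qw conformal_radius_slit_map_0 slit_map_def\<close>)
      from inv[OF this t(1)] obtain u where u: "cmod u < 1"
        "slit_map u = exp (- 1 * of_real t) * (1 + c * \<sigma>) - Q (e *\<^sub>C w)"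
        "norm (e *\<^sub>C w) ^ r < conformal_radius slit_map u"
        unfolding op_exp_block_op img e_def[symmetric] by blast
      have "Q (e *\<^sub>C w) = e ^ r * (c * \<sigma>)"
        unfolding homogeneous_polynomial_scaleC[OF Q] Qw ..
      then have slit: "slit_map u = exp (- of_real t) * (1 + c * \<sigma> * (1 - exp (- \<nu> * of_real s)))"
        unfolding u(2) er by (simp add: algebra_simps)
      have "norm (e *\<^sub>C w) ^ r = cmod (e ^ r) * \<sigma>"
        by (simp add: norm_scaleC power_mult_distrib norm_power w)
      then have "exp (- t) * (exp (- Re \<nu> * s) * \<sigma>) = norm (e *\<^sub>C w) ^ r"
        unfolding er by (simp add: norm_mult)
      also have "\<dots> \<le> conformal_radius slit_map u" using u(3) by simp
      \<comment> \<open>The slit map omits 0, so the quarter theorem bounds the conformal radius by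
        the distance to the tip. The factor \<open>exp (- t)\<close> then cancels.\<close>
      also have "\<dots> \<le> 4 * cmod (0 - slit_map u)"
        by (rule koebe_quarter_at[OF holh inj u(1)]) (use slit_map_nonzero in force)
      also have "\<dots> = exp (- t) * (4 * cmod (1 + c * \<sigma> * (1 - exp (- \<nu> * of_real s))))"
        by (simp add: slit norm_mult)
      finally show ?thesis by (simp only: mult_le_cancel_left_pos exp_gt_zero)
    qed
    \<comment> \<open>The criterion for the image is strict and admits only
      \<open>\<sigma> < 4\<close>; the limit \<open>\<sigma> = 4\<close> is the case that the choice
      of \<open>s\<close> contradicts.\<close>
    have "exp (- Re \<nu> * s) * 4 \<le> 4 * cmod (1 + c * of_real 4 * (1 - exp (- \<nu> * of_real s)))"
    proof (rule tendsto_le[of "at_left (4 :: real)"])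
      show "((\<lambda>\<sigma>. exp (- Re \<nu> * s) * \<sigma>) \<longlongrightarrow> exp (- Re \<nu> * s) * 4) (at_left 4)"
        by (intro tendsto_intros)
      show "((\<lambda>\<sigma>. 4 * cmod (1 + c * of_real \<sigma> * (1 - exp (- \<nu> * of_real s)))) \<longlongrightarrow>
          4 * cmod (1 + c * of_real 4 * (1 - exp (- \<nu> * of_real s)))) (at_left 4)"
        by (intro tendsto_intros)
      show "\<forall>\<^sub>F \<sigma> in at_left 4. exp (- Re \<nu> * s) * \<sigma> \<le> 4 * cmod (1 + c * of_real \<sigma> * (1 - exp (- \<nu> * of_real s)))"
        by (rule eventually_mono[OF eventually_at_left_real[of 0 4]]) (use ineq in auto)
    qed simp
    with s(2) show False by (simp add: mult.commute)
  qed
  ultimately show ?thesis using that[OF disc_spirallike_slit_map p Q] by blast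
qed

text \<open>\<open>\<nu>\<close> is the \<lambda> of the informal statement, and \<open>p\<close>
  ranges over all branches of the root. Sharpness is obtained with \<open>\<mu> = 1\<close>, on the
  given space and in the given degree.\<close>

theorem theorem4:
  fixes r :: nat
  assumes "r \<ge> 1"
    and nonzero: "\<exists>y::'y::complex_banach. y \<noteq> 0"
  shows "(\<forall>\<mu> h p (Q :: 'y \<Rightarrow> complex) \<nu>.
            0 < Re \<mu> \<longrightarrow> disc_spirallike \<mu> h \<longrightarrow> root_branch r (deriv h) p \<longrightarrow>
            homogeneous_polynomial r Q \<longrightarrow> 0 < Re \<nu> \<longrightarrow>
            (SUP y\<in>sphere 0 1. cmod (Q y)) \<le> 1 / 4 * (Re \<nu> / cmod \<nu>) \<longrightarrow>
            op_spirallike (block_op r \<mu> \<nu>) (unit_ball_r r) (H_hat h p Q))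
       \<and> (\<forall>\<nu> C. 0 < Re \<nu> \<longrightarrow> 1 / 4 * (Re \<nu> / cmod \<nu>) < C \<longrightarrow>
            \<not> (\<forall>\<mu> h p (Q :: 'y \<Rightarrow> complex).
                  0 < Re \<mu> \<longrightarrow> disc_spirallike \<mu> h \<longrightarrow> root_branch r (deriv h) p \<longrightarrow>
                  homogeneous_polynomial r Q \<longrightarrow>
                  (SUP y\<in>sphere 0 1. cmod (Q y)) \<le> C \<longrightarrow>
                  op_spirallike (block_op r \<mu> \<nu>) (unit_ball_r r) (H_hat h p Q)))"
proof (intro conjI allI impI notI)
  show "op_spirallike (block_op r \<mu> \<nu>) (unit_ball_r r) (H_hat h p Q)"
    if "0 < Re \<mu>" "disc_spirallike \<mu> h" "root_branch r (deriv h) p" "homogeneous_polynomial r Q"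
      "0 < Re \<nu>" "(SUP y\<in>sphere 0 1. cmod (Q y)) \<le> 1 / 4 * (Re \<nu> / cmod \<nu>)"
    for \<mu> h p and Q :: "'y \<Rightarrow> complex" and \<nu>
    using H_hat_spirallike[OF \<open>r \<ge> 1\<close> that] .
next
  fix \<nu> C
  assume "0 < Re \<nu>" "1 / 4 * (Re \<nu> / cmod \<nu>) < C"
    and *: "\<forall>\<mu> h p (Q :: 'y \<Rightarrow> complex).
      0 < Re \<mu> \<longrightarrow> disc_spirallike \<mu> h \<longrightarrow> root_branch r (deriv h) p \<longrightarrow>
      homogeneous_polynomial r Q \<longrightarrow> (SUP y\<in>sphere 0 1. cmod (Q y)) \<le> C \<longrightarrow>
      op_spirallike (block_op r \<mu> \<nu>) (unit_ball_r r) (H_hat h p Q)"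
  obtain h p and Q :: "'y \<Rightarrow> complex" where "disc_spirallike 1 h" "root_branch r (deriv h) p"
    "homogeneous_polynomial r Q" "(SUP y\<in>sphere 0 1. cmod (Q y)) \<le> C"
    "\<not> op_spirallike (block_op r 1 \<nu>) (unit_ball_r r) (H_hat h p Q)"
    using H_hat_bound_sharp[OF \<open>r \<ge> 1\<close> nonzero \<open>0 < Re \<nu>\<close> \<open>1 / 4 * (Re \<nu> / cmod \<nu>) < C\<close>] .
  moreover have "0 < Re 1" by simp
  ultimately show False using * by blast
qed

end
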